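(* Suppose $U:\mathbb R\to[0,1]$ is measurable with $\mathbb E_\xi[\xi U(\xi)]\ne0$. Let $\delta'>0$ and let $E(U)\subseteq[-E_{\max}(U),E_{\max}(U)]$ be a measurable set of positive Lebesgue measure $|E(U)|$, with $E_{\max}(U)<\infty$, such that $U(x)>\delta'$ for all $x\in E(U)$. Let $M\le N$, let $\boldsymbol G$ be an $M\times N$ matrix with i.i.d. standard Gaussian entries, and write $\boldsymbol Z=\boldsymbol Z(\boldsymbol G)$. Then for $\tau=\exp(-12)$ we have $$\mathbb P\bigg(\frac1N\Big|\log_{N\tau}\Big(\frac{\boldsymbol Z}{2^N}\Big)-\mathbb E\log_{N\tau}\Big(\frac{\boldsymbol Z}{2^N}\Big)\Big|\ge\frac{(\log N)^2}{N^{1/2}}\bigg)\le\frac1{N^2}$$ for all $N$ large enough, depending only on $|E(U)|$, $E_{\max}(U)$ and $\delta'$.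
   Context: $\xi$ is a standard Gaussian random variable. For an $M\times N$ matrix $\boldsymbol G$ with rows $\mathbf g^1,\dots,\mathbf g^M$, $\boldsymbol Z(\boldsymbol G)=\sum_{J\in\{-1,+1\}^N}\prod_{a\le M}U\big((\mathbf g^a,J)/N^{1/2}\big)$. The truncated logarithm is $\log_A(x)=\max\{-A,\log x\}$ (with $\log 0=-\infty$). *)

theory Defs
  imports "HOL-Probability.Probability"
begin

definition std_gaussian :: "real measure" where
  "std_gaussian = density lborel std_normal_density"

(* The value -A at x = 0 implements log 0 = -infinity (the library has ln 0 = 0).
   Only x >= 0 is relevant. *)
definition trunc_log :: "real \<Rightarrow> real \<Rightarrow> real" where
  "trunc_log A x = (if x > 0 then max (- A) (ln x) else - A)"

(* An M x N matrix is G :: nat => nat => real, with entry G a i for a < M, i < N. *)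
definition partition_Z :: "(real \<Rightarrow> real) \<Rightarrow> nat \<Rightarrow> nat \<Rightarrow> (nat \<Rightarrow> nat \<Rightarrow> real) \<Rightarrow> real" where
  "partition_Z U M N G =
     (\<Sum>J\<in>{..<N} \<rightarrow>\<^sub>E {-1, 1 :: real}. \<Prod>a<M. U ((\<Sum>i<N. G a i * J i) / sqrt (real N)))"

(* The law of the family of entries, indexed by the pairs (a, i);
   distr_eq_gaussian_matrix: any family of i.i.d. standard Gaussian entries,
   on any probability space, has this law. *)
definition gaussian_matrix :: "nat \<Rightarrow> nat \<Rightarrow> (nat \<times> nat \<Rightarrow> real) measure" where
  "gaussian_matrix M N = (\<Pi>\<^sub>M p\<in>{..<M} \<times> {..<N}. std_gaussian)"

lemma (in prob_space) distr_eq_gaussian_matrix: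
  fixes X :: "nat \<times> nat \<Rightarrow> 'a \<Rightarrow> real"
  assumes indep: "indep_vars (\<lambda>_. borel) X ({..<m} \<times> {..<n})"
    and normal: "\<And>p. p \<in> {..<m} \<times> {..<n} \<Longrightarrow> distributed M lborel (X p) std_normal_density"
  shows "distr M (\<Pi>\<^sub>M p\<in>{..<m} \<times> {..<n}. borel) (\<lambda>\<omega>. \<lambda>p\<in>{..<m} \<times> {..<n}. X p \<omega>)
           = gaussian_matrix m n"
proof (cases "{..<m} \<times> {..<n} = {}")
  case True
  interpret D: prob_space
    "distr M (\<Pi>\<^sub>M p\<in>({}::(nat \<times> nat) set). (borel :: real measure)) (\<lambda>\<omega>. \<lambda>p\<in>{}. X p \<omega>)"
    by (rule prob_space_distr, rule measurable_restrict) simp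
  have "distr M (\<Pi>\<^sub>M p\<in>({}::(nat \<times> nat) set). (borel :: real measure)) (\<lambda>\<omega>. \<lambda>p\<in>{}. X p \<omega>)
      = (\<Pi>\<^sub>M p\<in>{}. std_gaussian)"
  proof (rule measure_eqI)
    fix A assume "A \<in> sets (distr M (\<Pi>\<^sub>M p\<in>({}::(nat \<times> nat) set). (borel :: real measure))
      (\<lambda>\<omega>. \<lambda>p\<in>{}. X p \<omega>))"
    then have "A = {} \<or> A = {\<lambda>_. undefined}" by (auto simp: PiM_empty sets_count_space)
    then show "emeasure (distr M (\<Pi>\<^sub>M p\<in>({}::(nat \<times> nat) set). (borel :: real measure))
      (\<lambda>\<omega>. \<lambda>p\<in>{}. X p \<omega>)) A = emeasure (\<Pi>\<^sub>M p\<in>{}. std_gaussian) A"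
      using D.emeasure_space_1 by (auto simp: PiM_empty)
  qed (simp add: PiM_empty)
  then show ?thesis unfolding gaussian_matrix_def True by simp
next
  case False
  have rv: "random_variable borel (X p)" if "p \<in> {..<m} \<times> {..<n}" for p
    using indep that by (auto simp: indep_vars_def)
  have law: "distr M borel (X p) = std_gaussian" if "p \<in> {..<m} \<times> {..<n}" for p
    using distributed_distr_eq_density[OF normal[OF that]]
    by (simp add: std_gaussian_def cong: distr_cong)
  show ?thesis
    using indep_vars_iff_distr_eq_PiM'[where X = X and M' = "\<lambda>_. borel", OF False rv] indep
    by (simp add: gaussian_matrix_def law cong: PiM_cong)
qed

end

theory Submission
  imports Defs "HOL-Real_Asymp.Real_Asymp"
begin

text \<open>
  Let \<open>A = N exp (- 12)\<close> be the truncation level. Removing row \<open>a\<close> from the matrix gives a partition function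
  \<open>Z\<^sub>a \<ge> Z\<close> that is independent of this row, and \<open>Z / Z\<^sub>a\<close> is the average \<open>p\<close> of \<open>U ((g, J) / sqrt N)\<close>, with
  \<open>g\<close> the removed row and \<open>J\<close> drawn from the Gibbs measure of the other rows. If
  \<open>Z\<^sub>a / 2 ^ N \<le> exp (- A)\<close>, the truncation hides row \<open>a\<close>. Otherwise the Gibbs measure has density at most
  \<open>exp A\<close> with respect to the uniform measure on the cube, and the core of the proof
  (\<open>gibbs_average_small_probability\<close>) shows that \<open>p < 1 / n\<close>, with \<open>n\<close> about \<open>sqrt N\<close>, has a probability far
  below \<open>N powr (- 4)\<close>. So a row changes the truncated logarithm by at most \<open>ln n \<le> ln N / 2\<close>, up to an
  error that is negligible in mean. An Azuma inequality that tolerates such errors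
  (\<open>block_concentration\<close>) then bounds the probability of a deviation of at least \<open>sqrt N * (ln N)\<^sup>2\<close> by
  \<open>2 * exp (- 2 * (ln N)\<^sup>2)\<close> plus an error of at most \<open>1 / (2 * N\<^sup>2)\<close>.

  Why \<open>p\<close> is rarely small: if \<open>p < 1 / n\<close>, then \<open>n\<close> independent samples of the Gibbs measure all fail
  with probability at least \<open>(1 - 1 / n) ^ n\<close>, so it suffices to bound the expectation of \<open>(1 - p) ^ n\<close>.
  Reveal the samples one after the other. As \<open>A\<close> is a small multiple of \<open>N\<close>, the density bound forces
  each new sample to be almost orthogonal to the span of the at most \<open>n\<close> earlier ones
  (\<open>gibbs_bad_weight\<close>): a share of at most \<open>\<epsilon>\<close> of its squared length lies in the span. Its field
  therefore is \<open>m + \<sigma> t\<close>, where \<open>t\<close> is Gaussian and independent of the earlier fields, \<open>\<sigma>\<^sup>2 \<ge> 1 / 2\<close>, and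
  \<open>m\<close> has variance at most \<open>\<epsilon>\<close> (\<open>fresh_direction\<close>). With \<open>\<epsilon>\<close> small, \<open>m\<^sup>2 \<le> ln N / 8\<close> holds up to
  probability \<open>2 * N powr (- 8)\<close>, and then the field hits the set \<open>E\<close>, where \<open>U > \<delta>'\<close>, with conditional
  probability at least a constant times \<open>N powr (- 1 / 4)\<close>. About \<open>sqrt N\<close> attempts are more than enough
  for one of them to succeed.
\<close>

section \<open>Gaussian vectors\<close>

definition dot :: "'i set \<Rightarrow> ('i \<Rightarrow> real) \<Rightarrow> ('i \<Rightarrow> real) \<Rightarrow> real" where
  "dot I x y = (\<Sum>i\<in>I. x i * y i)"

definition gauss :: "'i set \<Rightarrow> ('i \<Rightarrow> real) measure" where
  "gauss I = (\<Pi>\<^sub>M i\<in>I. std_gaussian)"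

text \<open>
  Translation by \<open>s\<close> times \<open>v\<close>, restricted to \<open>I\<close> so that the result is again a point of the product
  space.
\<close>
definition move :: "'i set \<Rightarrow> ('i \<Rightarrow> real) \<Rightarrow> real \<Rightarrow> ('i \<Rightarrow> real) \<Rightarrow> ('i \<Rightarrow> real)" where
  "move I x s v = (\<lambda>i\<in>I. x i + s * v i)"

lemma sets_std_gaussian [simp, measurable_cong]: "sets std_gaussian = sets borel"
  by (simp add: std_gaussian_def)

lemma space_std_gaussian [simp]: "space std_gaussian = UNIV"
  by (simp add: std_gaussian_def)

lemma prob_space_std_gaussian: "prob_space std_gaussian"
  unfolding std_gaussian_def by (rule prob_space_normal_density) simp

interpretation std_gaussian: prob_space std_gaussian
  by (rule prob_space_std_gaussian)

interpretation gauss_prod: product_prob_space "\<lambda>_. std_gaussian" I for I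
  by standard

lemma prob_space_gauss: "prob_space (gauss I)"
  unfolding gauss_def by (rule gauss_prod.P.prob_space_axioms)

interpretation gauss: prob_space "gauss I" for I
  by (rule prob_space_gauss)

lemma sets_gauss [measurable_cong]: "sets (gauss I) = sets (\<Pi>\<^sub>M i\<in>I. (borel :: real measure))"
  unfolding gauss_def by (rule sets_PiM_cong) auto

lemma measurable_dot [measurable]: "(\<lambda>x. dot I x v) \<in> borel_measurable (gauss I)"
  unfolding dot_def by measurable

lemma dot_commute: "dot I x y = dot I y x"
  by (simp add: dot_def mult.commute)

lemma dot_move_left: "dot I (move I x s v) y = dot I x y + s * dot I v y"
  by (simp add: dot_def move_def algebra_simps sum.distrib sum_distrib_left)

lemma dot_self_nonneg: "dot I v v \<ge> 0"
  by (simp add: dot_def sum_nonneg)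

lemma measurable_move [measurable (raw)]:
  assumes [measurable]: "f \<in> measurable M (gauss I)" "s \<in> borel_measurable M"
  shows "(\<lambda>x. move I (f x) (s x) v) \<in> measurable M (gauss I)"
proof -
  have "(\<lambda>x. f x i) \<in> borel_measurable M" if "i \<in> I" for i
  proof -
    have "(\<lambda>x. x i) \<in> borel_measurable (gauss I)" using that by measurable
    from measurable_compose[OF assms(1) this] show ?thesis .
  qed
  hence "(\<lambda>x. \<lambda>i\<in>I. f x i + s x * v i) \<in> measurable M (\<Pi>\<^sub>M i\<in>I. borel)"
    by (intro measurable_restrict) auto
  thus ?thesis unfolding move_def
    using measurable_cong_sets[OF refl sets_gauss] by blast
qed

lemma nn_integral_std_gaussian:
  assumes [measurable]: "f \<in> borel_measurable borel"
  shows "(\<integral>\<^sup>+x. f x \<partial>std_gaussian) = (\<integral>\<^sup>+x. ennreal (std_normal_density x) * f x \<partial>lborel)"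
  unfolding std_gaussian_def by (subst nn_integral_density) auto

text \<open>
  Translating a Gaussian costs the exponential density on the right: this is the ratio of the
  normal densities with means \<open>a\<close> and \<open>0\<close>.
\<close>
lemma std_gaussian_shift:
  fixes f :: "real \<Rightarrow> ennreal"
  assumes [measurable]: "f \<in> borel_measurable borel"
  shows "(\<integral>\<^sup>+x. f (x + a) \<partial>std_gaussian) = (\<integral>\<^sup>+x. f x * ennreal (exp (a * x - a\<^sup>2 / 2)) \<partial>std_gaussian)"
proof -
  have "(\<integral>\<^sup>+x. f (x + a) \<partial>std_gaussian) = (\<integral>\<^sup>+x. ennreal (std_normal_density x) * f (x + a) \<partial>lborel)"
    by (simp add: nn_integral_std_gaussian)
  also have "\<dots> = (\<integral>\<^sup>+x. ennreal (std_normal_density (x - a)) * f x \<partial>lborel)"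
    by (subst nn_integral_real_affine[where c = 1 and t = "-a"]) (auto simp: algebra_simps)
  also have "\<dots> = (\<integral>\<^sup>+x. ennreal (std_normal_density x) * (f x * ennreal (exp (a * x - a\<^sup>2 / 2))) \<partial>lborel)"
  proof (intro nn_integral_cong)
    fix x :: real
    have "std_normal_density (x - a) = std_normal_density x * exp (a * x - a\<^sup>2 / 2)"
      by (simp add: std_normal_density_def power2_eq_square field_simps flip: exp_add)
    thus "ennreal (std_normal_density (x - a)) * f x =
        ennreal (std_normal_density x) * (f x * ennreal (exp (a * x - a\<^sup>2 / 2)))"
      by (simp add: ennreal_mult' mult_ac)
  qed
  also have "\<dots> = (\<integral>\<^sup>+x. f x * ennreal (exp (a * x - a\<^sup>2 / 2)) \<partial>std_gaussian)"
    by (simp add: nn_integral_std_gaussian)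
  finally show ?thesis .
qed

text \<open>
  The Cameron-Martin formula in finite dimension. Both the translation and the density factor over
  the coordinates, so it follows from the one-dimensional formula one coordinate at a time.
\<close>
lemma gauss_shift:
  fixes f :: "('i \<Rightarrow> real) \<Rightarrow> ennreal"
  assumes "finite I" "f \<in> borel_measurable (gauss I)"
  shows "(\<integral>\<^sup>+x. f (move I x 1 v) \<partial>gauss I) = (\<integral>\<^sup>+x. f x * ennreal (exp (dot I x v - dot I v v / 2)) \<partial>gauss I)"
  using assms
proof (induction I arbitrary: f rule: finite_induct)
  case empty
  show ?case unfolding gauss_def
    using gauss_prod.nn_integral_empty[of "\<lambda>x. f (move {} x 1 v)"] gauss_prod.nn_integral_empty[of f]
    by (simp add: dot_def move_def gauss_prod.P.emeasure_space_1)
next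
  case (insert i I f)
  note [measurable] = insert.prems
  have ins: "(\<integral>\<^sup>+x. h x \<partial>gauss (insert i I)) = (\<integral>\<^sup>+y. (\<integral>\<^sup>+x. h (x(i := y)) \<partial>gauss I) \<partial>std_gaussian)"
    if "h \<in> borel_measurable (gauss (insert i I))" for h
    using gauss_prod.product_nn_integral_insert_rev[of I i h] that insert.hyps
    by (simp add: gauss_def)
  have ins': "(\<integral>\<^sup>+x. h x \<partial>gauss (insert i I)) = (\<integral>\<^sup>+x. (\<integral>\<^sup>+y. h (x(i := y)) \<partial>std_gaussian) \<partial>gauss I)"
    if "h \<in> borel_measurable (gauss (insert i I))" for h
    using gauss_prod.product_nn_integral_insert[of I i h] that insert.hyps
    by (simp add: gauss_def)
  have upd [measurable]: "(\<lambda>x. x(i := y)) \<in> measurable (gauss I) (gauss (insert i I))" for y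
    unfolding gauss_def by (rule measurable_fun_upd[where J = I]) auto
  have upd' [measurable]: "(\<lambda>y. x(i := y)) \<in> measurable borel (gauss (insert i I))" if "x \<in> space (gauss I)" for x
    unfolding gauss_def using that
    by (intro measurable_fun_upd[where J = I]) (auto simp: gauss_def)
  have mv: "move (insert i I) (x(i := y)) 1 v = (move I x 1 v)(i := y + v i)" for x y
    using insert.hyps by (auto simp: move_def fun_eq_iff)
  have dt: "dot (insert i I) (x(i := y)) v = y * v i + dot I x v" for x y
    using insert.hyps by (auto simp: dot_def intro!: sum.cong)
  have dv: "dot (insert i I) v v = (v i)\<^sup>2 + dot I v v"
    using insert.hyps by (auto simp: dot_def power2_eq_square)
  have "(\<integral>\<^sup>+x. f (move (insert i I) x 1 v) \<partial>gauss (insert i I))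
      = (\<integral>\<^sup>+y. (\<integral>\<^sup>+x. f ((move I x 1 v)(i := y + v i)) \<partial>gauss I) \<partial>std_gaussian)"
    by (subst ins) (auto simp: mv)
  also have "\<dots> = (\<integral>\<^sup>+y. (\<integral>\<^sup>+x. f (x(i := y + v i)) * ennreal (exp (dot I x v - dot I v v / 2)) \<partial>gauss I) \<partial>std_gaussian)"
    by (intro nn_integral_cong insert.IH) measurable
  also have "\<dots> = (\<integral>\<^sup>+y. (\<integral>\<^sup>+x. f (x(i := y)) * ennreal (exp (dot I x v - dot I v v / 2)) \<partial>gauss I)
      * ennreal (exp (v i * y - (v i)\<^sup>2 / 2)) \<partial>std_gaussian)"
  proof (rule std_gaussian_shift)
    have [measurable]: "(\<lambda>p. (snd p)(i := fst p)) \<in> measurable (borel \<Otimes>\<^sub>M gauss I) (gauss (insert i I))"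
      unfolding gauss_def by (rule measurable_fun_upd[where J = I]) (auto simp flip: gauss_def)
    show "(\<lambda>y. \<integral>\<^sup>+x. f (x(i := y)) * ennreal (exp (dot I x v - dot I v v / 2)) \<partial>gauss I) \<in> borel_measurable borel"
      by measurable
  qed
  also have "\<dots> = (\<integral>\<^sup>+y. (\<integral>\<^sup>+x. f (x(i := y)) *
      ennreal (exp (dot (insert i I) (x(i := y)) v - dot (insert i I) v v / 2)) \<partial>gauss I) \<partial>std_gaussian)"
  proof (intro nn_integral_cong, subst nn_integral_multc[symmetric])
    fix y :: real
    show "(\<lambda>x. f (x(i := y)) * ennreal (exp (dot I x v - dot I v v / 2))) \<in> borel_measurable (gauss I)"
      by measurable
    have "ennreal (exp (dot I x v - dot I v v / 2)) * ennreal (exp (v i * y - (v i)\<^sup>2 / 2)) =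
        ennreal (exp (dot (insert i I) (x(i := y)) v - dot (insert i I) v v / 2))" for x
      by (simp add: dt dv field_simps flip: ennreal_mult' exp_add)
    thus "(\<integral>\<^sup>+x. f (x(i := y)) * ennreal (exp (dot I x v - dot I v v / 2))
        * ennreal (exp (v i * y - (v i)\<^sup>2 / 2)) \<partial>gauss I) =
      (\<integral>\<^sup>+x. f (x(i := y)) *
        ennreal (exp (dot (insert i I) (x(i := y)) v - dot (insert i I) v v / 2)) \<partial>gauss I)"
      by (simp add: mult.assoc)
  qed
  also have "\<dots> = (\<integral>\<^sup>+x. f x * ennreal (exp (dot (insert i I) x v - dot (insert i I) v v / 2)) \<partial>gauss (insert i I))"
    by (subst ins) auto
  finally show ?case .
qed

lemma gauss_laplace:
  assumes "finite I"
  shows "(\<integral>\<^sup>+x. ennreal (exp (dot I x v)) \<partial>gauss I) = ennreal (exp (dot I v v / 2))"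
proof -
  have "1 = (\<integral>\<^sup>+x. ennreal (exp (dot I x v - dot I v v / 2)) \<partial>gauss I)"
    using gauss_shift[OF assms, of "\<lambda>_. 1" v] by (simp add: gauss.emeasure_space_1)
  hence "ennreal (exp (dot I v v / 2)) * 1 = ennreal (exp (dot I v v / 2)) * (\<integral>\<^sup>+x. ennreal (exp (dot I x v - dot I v v / 2)) \<partial>gauss I)"
    by simp
  also have "\<dots> = (\<integral>\<^sup>+x. ennreal (exp (dot I x v)) \<partial>gauss I)"
    by (subst nn_integral_cmult[symmetric]) (auto simp flip: ennreal_mult' exp_add)
  finally show ?thesis by simp
qed

text \<open>
  The component of a Gaussian vector along a unit vector \<open>v\<close> may be replaced by a fresh Gaussian
  variable. This is where later arguments find randomness that is independent of everything that
  has been looked at in directions orthogonal to \<open>v\<close>.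

  Instead of rotating the coordinates, one can translate. Substituting \<open>t = s + x \<bullet> v\<close> turns the right-hand
  side into an average of translates of \<open>f\<close> along \<open>s v\<close>; the Cameron-Martin formula moves the
  translation into the density, and what remains of the integral over \<open>s\<close> is the integral of the
  normal density with mean \<open>x \<bullet> v\<close>.
\<close>
lemma gauss_resample_direction:
  fixes f :: "('i \<Rightarrow> real) \<Rightarrow> ennreal"
  assumes fin: "finite I" and [measurable]: "f \<in> borel_measurable (gauss I)" and unit: "dot I v v = 1"
  shows "(\<integral>\<^sup>+x. f x \<partial>gauss I) = (\<integral>\<^sup>+x. (\<integral>\<^sup>+t. f (move I x (t - dot I x v) v) \<partial>std_gaussian) \<partial>gauss I)"
proof -
  let ?\<eta> = std_normal_density
  have ps: "pair_sigma_finite lborel (gauss I)"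
    by (intro pair_sigma_finite.intro sigma_finite_lborel gauss.sigma_finite_measure_axioms)
  have mv: "move I x s v = move I x 1 (\<lambda>i. s * v i)" for x s
    by (simp add: move_def)
  have "(\<integral>\<^sup>+x. (\<integral>\<^sup>+t. f (move I x (t - dot I x v) v) \<partial>std_gaussian) \<partial>gauss I)
      = (\<integral>\<^sup>+x. (\<integral>\<^sup>+s. ennreal (?\<eta> (dot I (move I x s v) v)) * f (move I x s v) \<partial>lborel) \<partial>gauss I)"
  proof (intro nn_integral_cong)
    fix x assume [simp]: "x \<in> space (gauss I)"
    have "(\<integral>\<^sup>+t. f (move I x (t - dot I x v) v) \<partial>std_gaussian)
        = (\<integral>\<^sup>+t. ennreal (?\<eta> t) * f (move I x (t - dot I x v) v) \<partial>lborel)"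
      by (rule nn_integral_std_gaussian) measurable
    also have "\<dots> = (\<integral>\<^sup>+s. ennreal (?\<eta> (dot I (move I x s v) v)) * f (move I x s v) \<partial>lborel)"
      by (subst nn_integral_real_affine[where c = 1 and t = "dot I x v"]) (auto simp: dot_move_left unit)
    finally show "(\<integral>\<^sup>+t. f (move I x (t - dot I x v) v) \<partial>std_gaussian) =
       (\<integral>\<^sup>+s. ennreal (?\<eta> (dot I (move I x s v) v)) * f (move I x s v) \<partial>lborel)" .
  qed
  also have "\<dots> = (\<integral>\<^sup>+s. (\<integral>\<^sup>+x. ennreal (?\<eta> (dot I (move I x s v) v)) * f (move I x s v) \<partial>gauss I) \<partial>lborel)"
    by (rule pair_sigma_finite.Fubini'[OF ps]) (simp add: dot_move_left unit)
  also have "\<dots> = (\<integral>\<^sup>+s. (\<integral>\<^sup>+x. ennreal (?\<eta> (dot I x v)) * f x * ennreal (exp (s * dot I x v - s\<^sup>2 / 2)) \<partial>gauss I) \<partial>lborel)"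
  proof (rule nn_integral_cong)
    fix s :: real
    have "dot I x (\<lambda>i. s * v i) = s * dot I x v" for x
      by (simp add: dot_def sum_distrib_left mult_ac)
    moreover have "dot I (\<lambda>i. s * v i) (\<lambda>i. s * v i) = s\<^sup>2"
      using unit by (simp add: dot_def power2_eq_square mult_ac flip: sum_distrib_left)
    ultimately show "(\<integral>\<^sup>+x. ennreal (?\<eta> (dot I (move I x s v) v)) * f (move I x s v) \<partial>gauss I) =
      (\<integral>\<^sup>+x. ennreal (?\<eta> (dot I x v)) * f x * ennreal (exp (s * dot I x v - s\<^sup>2 / 2)) \<partial>gauss I)"
      unfolding mv[of _ s]
      by (subst gauss_shift[OF fin, of "\<lambda>x. ennreal (?\<eta> (dot I x v)) * f x"]) auto
  qed
  also have "\<dots> = (\<integral>\<^sup>+x. (\<integral>\<^sup>+s. ennreal (?\<eta> (dot I x v)) * f x * ennreal (exp (s * dot I x v - s\<^sup>2 / 2)) \<partial>lborel) \<partial>gauss I)"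
    by (rule pair_sigma_finite.Fubini'[OF ps, symmetric]) measurable
  also have "\<dots> = (\<integral>\<^sup>+x. f x \<partial>gauss I)"
  proof (intro nn_integral_cong)
    fix x assume "x \<in> space (gauss I)"
    let ?z = "dot I x v"
    have eq: "?\<eta> ?z * exp (s * ?z - s\<^sup>2 / 2) = normal_density ?z 1 s" for s
      by (simp add: normal_density_def power2_eq_square field_simps flip: exp_add)
    have "(\<integral>\<^sup>+s. ennreal (?\<eta> ?z) * f x * ennreal (exp (s * ?z - s\<^sup>2 / 2)) \<partial>lborel)
        = (\<integral>\<^sup>+s. f x * ennreal (normal_density ?z 1 s) \<partial>lborel)"
      by (intro nn_integral_cong) (simp add: ennreal_mult' mult_ac flip: eq)
    also have "\<dots> = f x * (\<integral>\<^sup>+s. ennreal (normal_density ?z 1 s) \<partial>lborel)"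
      by (rule nn_integral_cmult) measurable
    also have "(\<integral>\<^sup>+s. ennreal (normal_density ?z 1 s) \<partial>lborel) = 1"
      by (subst nn_integral_eq_integral) auto
    finally show "(\<integral>\<^sup>+s. ennreal (?\<eta> ?z) * f x * ennreal (exp (s * ?z - s\<^sup>2 / 2)) \<partial>lborel) = f x"
      by simp
  qed
  finally show ?thesis by simp
qed

lemma gauss_exp_square_quarter:
  assumes "finite I"
  shows "(\<integral>\<^sup>+z. ennreal (exp (dot I z z / 4)) \<partial>gauss I) = ennreal (sqrt 2 ^ card I)"
proof -
  have one: "(\<integral>\<^sup>+z. ennreal (exp (z * z / 4)) \<partial>std_gaussian) = ennreal (sqrt 2)"
  proof -
    have "(\<integral>\<^sup>+z. ennreal (exp (z * z / 4)) \<partial>std_gaussian)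
        = (\<integral>\<^sup>+z. ennreal (sqrt 2) * ennreal (normal_density 0 (sqrt 2) z) \<partial>lborel)"
      unfolding nn_integral_std_gaussian[of "\<lambda>z. ennreal (exp (z * z / 4))", simplified]
    proof (intro nn_integral_cong)
      fix z :: real
      have "std_normal_density z * exp (z * z / 4) = sqrt 2 * normal_density 0 (sqrt 2) z"
        by (simp add: normal_density_def power2_eq_square real_sqrt_mult field_simps flip: exp_add)
      thus "ennreal (std_normal_density z) * ennreal (exp (z * z / 4))
          = ennreal (sqrt 2) * ennreal (normal_density 0 (sqrt 2) z)"
        by (simp flip: ennreal_mult')
    qed
    also have "\<dots> = ennreal (sqrt 2) * (\<integral>\<^sup>+z. ennreal (normal_density 0 (sqrt 2) z) \<partial>lborel)"
      by (rule nn_integral_cmult) measurable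
    also have "(\<integral>\<^sup>+z. ennreal (normal_density 0 (sqrt 2) z) \<partial>lborel) = 1"
      by (subst nn_integral_eq_integral) auto
    finally show ?thesis by simp
  qed
  have "(\<integral>\<^sup>+z. ennreal (exp (dot I z z / 4)) \<partial>gauss I) = (\<integral>\<^sup>+z. (\<Prod>i\<in>I. ennreal (exp (z i * z i / 4))) \<partial>gauss I)"
    using assms by (intro nn_integral_cong) (simp add: dot_def sum_divide_distrib exp_sum prod_ennreal)
  also have "\<dots> = (\<Prod>i\<in>I. ennreal (sqrt 2))"
    unfolding gauss_def
    by (subst gauss_prod.product_nn_integral_prod[OF assms, of "\<lambda>_ z. ennreal (exp (z * z / 4))"]) (auto simp: one)
  also have "\<dots> = ennreal (sqrt 2 ^ card I)"
    by (simp add: ennreal_power)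
  finally show ?thesis .
qed

text \<open>
  Chernoff's bound with the optimal parameter \<open>R / \<epsilon>\<close>, applied to both signs.
\<close>
lemma gauss_tail:
  assumes fin: "finite I" and y: "dot I y y \<le> \<epsilon>" and \<epsilon>: "\<epsilon> > 0" and R: "R \<ge> 0"
  shows "emeasure (gauss I) {x \<in> space (gauss I). R < \<bar>dot I x y\<bar>} \<le> ennreal (2 * exp (- R\<^sup>2 / (2 * \<epsilon>)))"
proof -
  define s where "s = R / \<epsilon>"
  have s: "s \<ge> 0" using R \<epsilon> by (simp add: s_def)
  have lap: "(\<integral>\<^sup>+x. ennreal (exp (- s * R)) * ennreal (exp (dot I x (\<lambda>i. t * y i))) \<partial>gauss I) \<le> ennreal (exp (- R\<^sup>2 / (2 * \<epsilon>)))"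
    if t: "t\<^sup>2 = s\<^sup>2" for t
  proof -
    have "dot I (\<lambda>i. t * y i) (\<lambda>i. t * y i) = t\<^sup>2 * dot I y y"
      by (simp add: dot_def sum_distrib_left power2_eq_square mult_ac)
    also have "\<dots> \<le> s\<^sup>2 * \<epsilon>" unfolding t using y by (intro mult_left_mono) auto
    finally have "- s * R + dot I (\<lambda>i. t * y i) (\<lambda>i. t * y i) / 2 \<le> - s * R + s\<^sup>2 * \<epsilon> / 2" by simp
    also have "\<dots> = - R\<^sup>2 / (2 * \<epsilon>)"
      using \<epsilon> by (simp add: s_def power2_eq_square field_simps)
    finally have *: "- s * R + dot I (\<lambda>i. t * y i) (\<lambda>i. t * y i) / 2 \<le> - R\<^sup>2 / (2 * \<epsilon>)" .
    have "(\<integral>\<^sup>+x. ennreal (exp (- s * R)) * ennreal (exp (dot I x (\<lambda>i. t * y i))) \<partial>gauss I)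
        = ennreal (exp (- s * R)) * ennreal (exp (dot I (\<lambda>i. t * y i) (\<lambda>i. t * y i) / 2))"
      by (subst nn_integral_cmult) (auto simp: gauss_laplace[OF fin])
    also have "\<dots> = ennreal (exp (- s * R + dot I (\<lambda>i. t * y i) (\<lambda>i. t * y i) / 2))"
      by (simp flip: ennreal_mult' exp_add)
    also have "\<dots> \<le> ennreal (exp (- R\<^sup>2 / (2 * \<epsilon>)))"
      using * by (intro ennreal_leI) simp
    finally show ?thesis .
  qed
  let ?A = "{x \<in> space (gauss I). R < \<bar>dot I x y\<bar>}"
  have "emeasure (gauss I) ?A = (\<integral>\<^sup>+x. indicator ?A x \<partial>gauss I)"
    by (subst nn_integral_indicator) auto
  also have "\<dots> \<le> (\<integral>\<^sup>+x. ennreal (exp (- s * R)) * ennreal (exp (dot I x (\<lambda>i. s * y i)))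
      + ennreal (exp (- s * R)) * ennreal (exp (dot I x (\<lambda>i. - s * y i))) \<partial>gauss I)"
  proof (intro nn_integral_mono)
    fix x
    have dt: "dot I x (\<lambda>i. t * y i) = t * dot I x y" for t
      by (simp add: dot_def sum_distrib_left mult_ac)
    have "1 \<le> exp (- s * R) * exp (s * dot I x y) + exp (- s * R) * exp (- s * dot I x y)" if "R < \<bar>dot I x y\<bar>"
    proof -
      have "exp (- s * R) * exp (s * \<bar>dot I x y\<bar>) = exp (s * (\<bar>dot I x y\<bar> - R))"
        by (simp add: algebra_simps flip: exp_add)
      moreover have "s * (\<bar>dot I x y\<bar> - R) \<ge> 0" using s that by simp
      ultimately have "1 \<le> exp (- s * R) * exp (s * \<bar>dot I x y\<bar>)" by simp
      thus ?thesis
        by (auto simp: abs_if intro: add_increasing add_increasing2 split: if_splits)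
    qed
    hence "indicator ?A x \<le> ennreal (exp (- s * R) * exp (s * dot I x y) + exp (- s * R) * exp (- s * dot I x y))"
      by (auto simp: indicator_def simp del: ennreal_plus intro!: ennreal_leI)
    thus "indicator ?A x \<le> ennreal (exp (- s * R)) * ennreal (exp (dot I x (\<lambda>i. s * y i)))
      + ennreal (exp (- s * R)) * ennreal (exp (dot I x (\<lambda>i. - s * y i)))"
      unfolding dt by (simp flip: ennreal_mult')
  qed
  also have "\<dots> \<le> ennreal (exp (- R\<^sup>2 / (2 * \<epsilon>))) + ennreal (exp (- R\<^sup>2 / (2 * \<epsilon>)))"
    using lap[of s] lap[of "- s"] by (subst nn_integral_add) (auto intro!: add_mono)
  also have "\<dots> = ennreal (2 * exp (- R\<^sup>2 / (2 * \<epsilon>)))"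
    by (simp flip: ennreal_plus)
  finally show ?thesis .
qed

text \<open>
  A Gaussian with variance in \<open>{1 / 2..1}\<close> and mean at most \<open>R\<close> in absolute value hits a set
  \<open>E\<close> within distance \<open>K\<close> of the origin with a probability that decays only like \<open>exp (- (K + R)\<^sup>2)\<close>:
  all points of \<open>E\<close> are within \<open>K + R\<close> of the mean, and half a squared distance is divided by a
  variance of at least \<open>1 / 2\<close>.
\<close>
lemma gauss_miss_probability_le:
  fixes U :: "real \<Rightarrow> real"
  assumes [measurable]: "U \<in> borel_measurable borel" and U: "\<And>x. 0 \<le> U x" "\<And>x. U x \<le> 1"
    and E [measurable]: "E \<in> sets borel" and EK: "E \<subseteq> {-K..K}"
    and hit: "\<And>x. x \<in> E \<Longrightarrow> \<delta> \<le> U x" and "\<delta> > 0"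
    and \<sigma>: "\<sigma> > 0" "1 / 2 \<le> \<sigma>\<^sup>2" "\<sigma>\<^sup>2 \<le> 1" and m: "\<bar>m\<bar> \<le> R"
  shows "(\<integral>\<^sup>+t. ennreal (1 - U (m + \<sigma> * t)) \<partial>std_gaussian)
     \<le> ennreal (1 - \<delta> / sqrt (2 * pi) * exp (- (K + R)\<^sup>2) * measure lborel E)"
proof -
  define \<kappa> where "\<kappa> = \<delta> / sqrt (2 * pi) * exp (- (K + R)\<^sup>2)"
  have \<kappa>: "\<kappa> > 0" using \<open>\<delta> > 0\<close> by (simp add: \<kappa>_def)
  have \<sigma>1: "\<sigma> \<le> 1" using \<sigma> by (simp add: power_le_one_iff abs_square_le_1)
  have emE: "emeasure lborel E = ennreal (measure lborel E)"
  proof (rule emeasure_eq_ennreal_measure)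
    have "emeasure lborel E \<le> emeasure lborel {-K..K}" by (rule emeasure_mono[OF EK]) simp
    thus "emeasure lborel E \<noteq> top" by (auto simp: emeasure_lborel_Icc_eq top_unique split: if_splits)
  qed
  define g where "g y = std_normal_density ((y - m) / \<sigma>) * U y" for y
  have [measurable]: "g \<in> borel_measurable borel" unfolding g_def by measurable
  have gE: "\<kappa> \<le> g y" if "y \<in> E" for y
  proof -
    have "\<bar>y - m\<bar> \<le> K + R" using EK that m by fastforce
    hence "(y - m)\<^sup>2 \<le> (K + R)\<^sup>2" by (metis abs_ge_zero abs_of_nonneg order_trans power2_abs power_mono)
    moreover have "((y - m) / \<sigma>)\<^sup>2 / 2 \<le> (y - m)\<^sup>2"
    proof -
      have "(y - m)\<^sup>2 * 1 \<le> (y - m)\<^sup>2 * (\<sigma>\<^sup>2 * 2)" using \<sigma> by (intro mult_left_mono) auto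
      thus ?thesis using \<sigma> by (simp add: power_divide field_simps)
    qed
    ultimately have "exp (- (K + R)\<^sup>2) \<le> exp (- ((y - m) / \<sigma>)\<^sup>2 / 2)" by simp
    hence "\<kappa> \<le> std_normal_density ((y - m) / \<sigma>) * \<delta>"
      using \<open>\<delta> > 0\<close> by (simp add: \<kappa>_def std_normal_density_def field_simps)
    also have "\<dots> \<le> g y" unfolding g_def using hit[OF that] by (intro mult_left_mono) auto
    finally show ?thesis .
  qed
  have "ennreal (\<kappa> * measure lborel E) = (\<integral>\<^sup>+y. ennreal \<kappa> * indicator E y \<partial>lborel)"
    using \<kappa> by (simp add: nn_integral_cmult_indicator emE ennreal_mult')
  also have "\<dots> \<le> (\<integral>\<^sup>+y. ennreal (g y) \<partial>lborel)"
    using gE U by (intro nn_integral_mono) (auto simp: indicator_def intro!: ennreal_leI)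
  also have "\<dots> = ennreal \<sigma> * (\<integral>\<^sup>+t. ennreal (g (m + \<sigma> * t)) \<partial>lborel)"
    using \<sigma> by (subst nn_integral_real_affine[where c = \<sigma> and t = m]) auto
  also have "\<dots> \<le> 1 * (\<integral>\<^sup>+t. ennreal (g (m + \<sigma> * t)) \<partial>lborel)"
    using \<sigma>1 by (intro mult_right_mono) auto
  also have "\<dots> = (\<integral>\<^sup>+t. ennreal (U (m + \<sigma> * t)) \<partial>std_gaussian)"
    using \<sigma> U by (simp add: nn_integral_std_gaussian g_def ennreal_mult)
  also have "\<dots> = ennreal (\<integral>t. U (m + \<sigma> * t) \<partial>std_gaussian)"
    using U by (intro nn_integral_eq_integral std_gaussian.integrable_const_bound[where B = 1]) auto
  finally have low: "\<kappa> * measure lborel E \<le> (\<integral>t. U (m + \<sigma> * t) \<partial>std_gaussian)"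
    using U by (subst (asm) ennreal_le_iff) (auto intro!: integral_nonneg_AE)
  have int: "integrable std_gaussian (\<lambda>t. U (m + \<sigma> * t))"
    using U by (intro std_gaussian.integrable_const_bound[where B = 1]) auto
  have "(\<integral>\<^sup>+t. ennreal (1 - U (m + \<sigma> * t)) \<partial>std_gaussian) = ennreal (\<integral>t. 1 - U (m + \<sigma> * t) \<partial>std_gaussian)"
    using U int by (intro nn_integral_eq_integral) auto
  also have "(\<integral>t. 1 - U (m + \<sigma> * t) \<partial>std_gaussian) = 1 - (\<integral>t. U (m + \<sigma> * t) \<partial>std_gaussian)"
    using int std_gaussian.prob_space by simp
  also have "ennreal \<dots> \<le> ennreal (1 - \<kappa> * measure lborel E)"
    using low by (intro ennreal_leI) auto
  finally show ?thesis by (simp add: \<kappa>_def)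
qed

section \<open>Projections of random sign vectors\<close>

text \<open>
  The estimate of the hyperbolic cosine, which is the fair-coin case of the inequality behind Hoeffding's
  lemma.
\<close>
lemma exp_plus_exp_uminus_le: "exp c + exp (- c) \<le> 2 * exp (c\<^sup>2 / 2)" for c :: real
proof -
  have *: "exp c + exp (- c) \<le> 2 * exp (c\<^sup>2 / 2)" if "c \<ge> 0" for c :: real
  proof -
    have "- (2 * c) * (1 / 2) + ln (1 + 1 / 2 * (exp (2 * c) - 1)) \<le> (2 * c)\<^sup>2 / 8"
      using Hoeffdings_lemma_aux[of "2 * c" "1 / 2"] that by simp
    hence "ln (1 + 1 / 2 * (exp (2 * c) - 1)) \<le> c + c\<^sup>2 / 2"
      by (simp add: power_mult_distrib)
    hence "exp (ln (1 + 1 / 2 * (exp (2 * c) - 1))) \<le> exp (c + c\<^sup>2 / 2)"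
      by simp
    moreover have "1 + 1 / 2 * (exp (2 * c) - 1) > 0"
      using that by (intro add_pos_nonneg) auto
    ultimately have "1 + 1 / 2 * (exp (2 * c) - 1) \<le> exp (c + c\<^sup>2 / 2)"
      by (simp only: exp_ln)
    hence "(1 + exp (2 * c)) * exp (- c) \<le> 2 * exp (c + c\<^sup>2 / 2) * exp (- c)"
      by (intro mult_right_mono) (auto simp: field_simps)
    thus ?thesis by (simp add: algebra_simps flip: exp_add)
  qed
  show ?thesis using *[of c] *[of "- c"] by (cases "c \<ge> 0") (auto simp: add.commute)
qed

definition orthonormal :: "'i set \<Rightarrow> nat \<Rightarrow> (nat \<Rightarrow> 'i \<Rightarrow> real) \<Rightarrow> bool" where
  "orthonormal I k v \<longleftrightarrow> (\<forall>l<k. \<forall>l'<k. dot I (v l) (v l') = of_bool (l = l'))"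

abbreviation cube :: "'i set \<Rightarrow> ('i \<Rightarrow> real) set" where
  "cube I \<equiv> I \<rightarrow>\<^sub>E {- 1, 1}"

text \<open>
  For orthonormal \<open>v 0, ..., v (k - 1)\<close> this is the squared length of the projection of \<open>x\<close> to their
  span.
\<close>
definition proj_sq :: "'i set \<Rightarrow> nat \<Rightarrow> (nat \<Rightarrow> 'i \<Rightarrow> real) \<Rightarrow> ('i \<Rightarrow> real) \<Rightarrow> real" where
  "proj_sq I k v x = (\<Sum>l<k. (dot I (v l) x)\<^sup>2)"

text \<open>
  A random sign vector has a squared projection to a \<open>k\<close>-dimensional space of order \<open>k\<close>, with an
  exponential tail. The exponential of a square is the average of exponentials of linear forms with
  Gaussian coefficients \<open>z\<close>. For fixed \<open>z\<close> the sum over the cube factors, and the estimate of the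
  hyperbolic cosine replaces the signs by Gaussians; orthonormality then leaves the Gaussian average
  of \<open>exp (dot z z / 4)\<close>, which is \<open>sqrt 2\<close> per dimension.
\<close>
lemma cube_exp_proj_sq_le:
  assumes fin: "finite I" and on: "orthonormal I k v"
  shows "(\<Sum>J\<in>cube I. exp (proj_sq I k v J / 4)) \<le> 2 ^ card I * sqrt 2 ^ k"
proof -
  define c where "c z i = (\<Sum>l<k. z l * v l i) / sqrt 2" for z i
  have dotc: "dot {..<k} z (\<lambda>l. dot I (v l) J / sqrt 2) = (\<Sum>i\<in>I. c z i * J i)" for z J
    unfolding dot_def c_def sum_divide_distrib sum_distrib_left sum_distrib_right
    by (subst sum.swap) (simp add: mult_ac)
  have c2: "(\<Sum>i\<in>I. (c z i)\<^sup>2 / 2) = dot {..<k} z z / 4" for z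
  proof -
    have "(\<Sum>i\<in>I. (c z i)\<^sup>2 / 2) = (\<Sum>i\<in>I. \<Sum>l<k. \<Sum>l'<k. z l * z l' * (v l i * v l' i)) / 4"
      by (simp add: c_def power_divide power2_eq_square sum_product sum_divide_distrib mult_ac)
    also have "(\<Sum>i\<in>I. \<Sum>l<k. \<Sum>l'<k. z l * z l' * (v l i * v l' i)) = (\<Sum>l<k. \<Sum>l'<k. z l * z l' * dot I (v l) (v l'))"
      unfolding dot_def sum_distrib_left
      by (subst sum.swap, intro sum.cong refl, subst sum.swap, rule refl)
    also have "\<dots> = (\<Sum>l<k. \<Sum>l'<k. if l' = l then z l * z l' else 0)"
      using on by (intro sum.cong refl) (auto simp: orthonormal_def)
    also have "\<dots> = dot {..<k} z z" by (simp add: dot_def)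
    finally show ?thesis .
  qed
  have "ennreal (\<Sum>J\<in>cube I. exp (proj_sq I k v J / 4)) = (\<Sum>J\<in>cube I. ennreal (exp (proj_sq I k v J / 4)))"
    by (simp add: sum_ennreal)
  also have "\<dots> = (\<Sum>J\<in>cube I. \<integral>\<^sup>+z. ennreal (exp (\<Sum>i\<in>I. c z i * J i)) \<partial>gauss {..<k})"
  proof (intro sum.cong refl)
    fix J
    have "proj_sq I k v J / 4 = dot {..<k} (\<lambda>l. dot I (v l) J / sqrt 2) (\<lambda>l. dot I (v l) J / sqrt 2) / 2"
      by (simp add: proj_sq_def dot_def[of "{..<k}"] power2_eq_square sum_divide_distrib)
    thus "ennreal (exp (proj_sq I k v J / 4)) = (\<integral>\<^sup>+z. ennreal (exp (\<Sum>i\<in>I. c z i * J i)) \<partial>gauss {..<k})"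
      by (simp add: gauss_laplace flip: dotc)
  qed
  also have "\<dots> = (\<integral>\<^sup>+z. (\<Sum>J\<in>cube I. ennreal (exp (\<Sum>i\<in>I. c z i * J i))) \<partial>gauss {..<k})"
    by (subst nn_integral_sum) (auto simp flip: dotc)
  also have "\<dots> \<le> (\<integral>\<^sup>+z. ennreal (2 ^ card I) * ennreal (exp (dot {..<k} z z / 4)) \<partial>gauss {..<k})"
  proof (intro nn_integral_mono)
    fix z
    have "(\<Sum>J\<in>cube I. exp (\<Sum>i\<in>I. c z i * J i)) = (\<Sum>J\<in>cube I. \<Prod>i\<in>I. exp (c z i * J i))"
      using fin by (simp add: exp_sum)
    also have "\<dots> = (\<Prod>i\<in>I. \<Sum>s\<in>{- 1, 1}. exp (c z i * s))"
      using fin by (subst prod_sum_PiE) auto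
    also have "\<dots> \<le> (\<Prod>i\<in>I. 2 * exp ((c z i)\<^sup>2 / 2))"
      using exp_plus_exp_uminus_le by (intro prod_mono) (auto simp: add.commute)
    also have "\<dots> = 2 ^ card I * exp (dot {..<k} z z / 4)"
      using fin by (simp add: prod.distrib exp_sum flip: c2)
    finally show "(\<Sum>J\<in>cube I. ennreal (exp (\<Sum>i\<in>I. c z i * J i)))
        \<le> ennreal (2 ^ card I) * ennreal (exp (dot {..<k} z z / 4))"
      by (simp add: sum_ennreal flip: ennreal_mult')
  qed
  also have "\<dots> = ennreal (2 ^ card I * sqrt 2 ^ k)"
  proof -
    have [measurable]: "(\<lambda>z. dot {..<k} z z) \<in> borel_measurable (gauss {..<k})"
      unfolding dot_def by measurable
    show ?thesis
      by (subst nn_integral_cmult) (auto simp: gauss_exp_square_quarter ennreal_mult)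
  qed
  finally show ?thesis by (subst (asm) ennreal_le_iff) auto
qed

section \<open>Gibbs averages and replicas\<close>

text \<open>
  The value \<open>B x\<close> depends on \<open>x\<close> only through its inner products with \<open>v 0, ..., v (k - 1)\<close>. It is
  phrased by moves orthogonal to these vectors because resampling is such a move.
\<close>
definition seen_by :: "'i set \<Rightarrow> nat \<Rightarrow> (nat \<Rightarrow> 'i \<Rightarrow> real) \<Rightarrow> (('i \<Rightarrow> real) \<Rightarrow> real) \<Rightarrow> bool" where
  "seen_by I k v B \<longleftrightarrow> (\<forall>x s r. (\<forall>l<k. dot I (v l) r = 0) \<longrightarrow> B (move I x s r) = B x)"

lemma dot_diff_right: "dot I x (\<lambda>i. y i - z i) = dot I x y - dot I x z"
  by (simp add: dot_def algebra_simps sum_subtractf)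

lemma dot_scale_right: "dot I x (\<lambda>i. c * y i) = c * dot I x y"
  by (simp add: dot_def algebra_simps sum_distrib_left)

lemma dot_sum_right: "dot I x (\<lambda>i. \<Sum>l\<in>L. y l i) = (\<Sum>l\<in>L. dot I x (y l))"
  unfolding dot_def sum_distrib_left by (subst sum.swap) simp

text \<open>
  One more sample. The vector \<open>J\<close> is split into its projection \<open>p\<close> to the span of the vectors seen so
  far and the rest, of direction \<open>e\<close>. Resampling the Gaussian vector along \<open>e\<close> leaves \<open>B\<close>
  unchanged and turns the normalised field of \<open>J\<close> into \<open>m + \<sigma> t\<close> with \<open>t\<close> fresh, where \<open>\<sigma>\<^sup>2 \<ge> 1 / 2\<close> and
  the mean \<open>m\<close>, the field of \<open>p\<close>, has variance at most \<open>\<epsilon>\<close>. So the factor \<open>q\<close> is gained except when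
  \<open>m\<close> exceeds \<open>R\<close>, which is rare because \<open>\<epsilon>\<close> is small. The new product is seen by the old
  vectors together with \<open>e\<close>, which makes the step repeatable.
\<close>
lemma fresh_direction:
  fixes b :: "real \<Rightarrow> real"
  assumes fin: "finite I" and N: "card I > 0" and on: "orthonormal I k v"
    and J: "dot I J J = real (card I)" and small: "proj_sq I k v J \<le> \<epsilon> * real (card I)"
    and \<epsilon>: "0 < \<epsilon>" "\<epsilon> \<le> 1 / 2" and R: "R \<ge> 0"
    and b [measurable]: "b \<in> borel_measurable borel" and b01: "\<And>x. 0 \<le> b x" "\<And>x. b x \<le> 1"
    and q: "\<And>m \<sigma>. \<lbrakk>\<sigma> > 0; 1 / 2 \<le> \<sigma>\<^sup>2; \<sigma>\<^sup>2 \<le> 1; \<bar>m\<bar> \<le> R\<rbrakk> \<Longrightarrow> (\<integral>\<^sup>+t. ennreal (b (m + \<sigma> * t)) \<partial>std_gaussian) \<le> ennreal q"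
    and "q \<ge> 0"
    and B [measurable]: "B \<in> borel_measurable (gauss I)" and B01: "\<And>x. 0 \<le> B x" "\<And>x. B x \<le> 1"
    and inv: "seen_by I k v B"
  shows "\<exists>v'. orthonormal I (Suc k) v' \<and> seen_by I (Suc k) v' (\<lambda>x. B x * b (dot I x J / sqrt (card I)))"
    and "(\<integral>x. B x * b (dot I x J / sqrt (card I)) \<partial>gauss I) \<le> q * (\<integral>x. B x \<partial>gauss I) + 2 * exp (- R\<^sup>2 / (2 * \<epsilon>))"
proof -
  let ?N = "real (card I)"
  have Npos: "?N > 0" using N by simp
  define p where "p i = (\<Sum>l<k. dot I (v l) J * v l i)" for i
  define r where "r i = J i - p i" for i
  define \<rho> where "\<rho> = sqrt (dot I r r)"
  define e where "e i = (1 / \<rho>) * r i" for i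
  have vp: "dot I (v l) p = dot I (v l) J" if "l < k" for l
  proof -
    have "dot I (v l) p = (\<Sum>l'<k. dot I (v l') J * dot I (v l) (v l'))"
      unfolding p_def by (simp add: dot_sum_right dot_scale_right)
    also have "\<dots> = (\<Sum>l'<k. if l' = l then dot I (v l') J else 0)"
      using on that by (intro sum.cong) (auto simp: orthonormal_def)
    finally show ?thesis using that by simp
  qed
  have vr: "dot I (v l) r = 0" if "l < k" for l
    unfolding r_def by (simp add: dot_diff_right vp[OF that])
  have xp: "dot I x p = (\<Sum>l<k. dot I (v l) J * dot I x (v l))" for x
    unfolding p_def by (simp add: dot_sum_right dot_scale_right)
  have pp: "dot I p p = proj_sq I k v J"
  proof -
    have "dot I p p = (\<Sum>l<k. dot I (v l) J * dot I (v l) p)"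
      by (subst xp) (simp add: dot_commute)
    thus ?thesis by (simp add: vp proj_sq_def power2_eq_square)
  qed
  have rp: "dot I r p = 0"
    by (simp add: xp dot_commute[of I r] vr)
  have xJ: "dot I x J = dot I x p + dot I x r" for x
    by (simp add: dot_def r_def algebra_simps flip: sum.distrib)
  have JJ: "?N = dot I p p + dot I r r"
  proof -
    have "dot I J J = dot I J p + dot I J r" by (rule xJ)
    also have "\<dots> = dot I p J + dot I r J" by (simp only: dot_commute)
    also have "\<dots> = dot I p p + dot I p r + (dot I r p + dot I r r)" by (simp only: xJ)
    also have "dot I p r = 0" by (subst dot_commute) (rule rp)
    finally show ?thesis using J rp by simp
  qed
  have p0: "dot I p p \<ge> 0" by (rule dot_self_nonneg)
  have rlow: "dot I r r \<ge> ?N / 2"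
  proof -
    have "\<epsilon> * ?N \<le> 1 / 2 * ?N" using \<epsilon> by (intro mult_right_mono) auto
    thus ?thesis using JJ pp small by linarith
  qed
  hence \<rho>: "\<rho> > 0" "\<rho>\<^sup>2 = dot I r r" using Npos by (auto simp: \<rho>_def dot_self_nonneg)
  have ve: "dot I (v l) e = 0" if "l < k" for l
    unfolding e_def dot_scale_right using vr[OF that] by simp
  have re: "dot I x r = \<rho> * dot I x e" for x
    unfolding e_def dot_scale_right using \<rho> by simp
  have ee: "dot I e e = 1"
  proof -
    have "dot I r r = \<rho> * dot I r e" by (rule re)
    also have "dot I r e = \<rho> * dot I e e" by (subst dot_commute) (rule re)
    finally have "\<rho>\<^sup>2 * dot I e e = \<rho>\<^sup>2 * 1"
      unfolding \<rho>(2)[symmetric] by (simp add: power2_eq_square)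
    moreover have "\<rho>\<^sup>2 \<noteq> 0" using \<rho>(1) by simp
    ultimately show ?thesis by (simp only: mult_cancel_left) simp
  qed
  have ep: "dot I e p = 0"
    unfolding xp using ve by (simp add: dot_commute[of I e "v _"])
  let ?v = "v(k := e)"
  have on': "orthonormal I (Suc k) ?v"
  proof -
    have "dot I (?v l) (?v l') = of_bool (l = l')" if ll: "l < Suc k" "l' < Suc k" for l l'
    proof -
      consider "l < k" "l' < k" | "l = k" "l' < k" | "l < k" "l' = k" | "l = k" "l' = k"
        using ll by (auto simp: less_Suc_eq)
      thus ?thesis
      proof cases
        case 1
        thus ?thesis using on by (simp add: orthonormal_def)
      next
        case 2
        thus ?thesis using ve[of l'] by (simp add: dot_commute)
      next
        case 3
        thus ?thesis using ve[of l] by simp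
      next
        case 4
        thus ?thesis using ee by simp
      qed
    qed
    thus ?thesis unfolding orthonormal_def by blast
  qed
  have inv': "seen_by I (Suc k) ?v (\<lambda>x. B x * b (dot I x J / sqrt (card I)))"
    unfolding seen_by_def
  proof (intro allI impI)
    fix x s z assume z: "\<forall>l<Suc k. dot I (?v l) z = 0"
    have vz: "dot I (v l) z = 0" if "l < k" for l using z[rule_format, of l] that by simp
    have ez: "dot I e z = 0" using z[rule_format, of k] by simp
    have "dot I z p = 0" unfolding xp using vz by (simp add: dot_commute[of I z "v _"])
    moreover have "dot I z r = 0" unfolding re using ez by (simp add: dot_commute[of I z e])
    ultimately have "dot I z J = 0" using xJ[of z] by simp
    thus "B (move I x s z) * b (dot I (move I x s z) J / sqrt (card I)) = B x * b (dot I x J / sqrt (card I))"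
      using inv vz by (simp add: seen_by_def dot_move_left)
  qed
  show "\<exists>v'. orthonormal I (Suc k) v' \<and> seen_by I (Suc k) v' (\<lambda>x. B x * b (dot I x J / sqrt (card I)))"
    using on' inv' by blast

  define \<sigma> where "\<sigma> = \<rho> / sqrt ?N"
  define y where "y i = p i / sqrt ?N" for i
  have \<sigma>: "\<sigma> > 0" "1 / 2 \<le> \<sigma>\<^sup>2" "\<sigma>\<^sup>2 \<le> 1"
    using \<rho> rlow JJ p0 Npos by (auto simp: \<sigma>_def power_divide field_simps)
  have xy: "dot I x y = dot I x p / sqrt ?N" for x
    by (simp add: dot_def y_def sum_divide_distrib)
  have yy: "dot I y y \<le> \<epsilon>"
    using small Npos by (simp add: dot_def[of I y y] y_def sum_divide_distrib[symmetric] field_simps pp[symmetric] dot_def[of I p p])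
  let ?A = "{x \<in> space (gauss I). R < \<bar>dot I x y\<bar>}"
  have [measurable]: "(\<lambda>x. dot I x y) \<in> borel_measurable (gauss I)" by measurable
  have "(\<integral>\<^sup>+x. ennreal (B x * b (dot I x J / sqrt ?N)) \<partial>gauss I)
      = (\<integral>\<^sup>+x. (\<integral>\<^sup>+t. ennreal (B x) * ennreal (b (dot I x y + \<sigma> * t)) \<partial>std_gaussian) \<partial>gauss I)"
  proof (subst gauss_resample_direction[OF fin _ ee], measurable, rule nn_integral_cong, rule nn_integral_cong)
    fix x t
    let ?x' = "move I x (t - dot I x e) e"
    have "B ?x' = B x" using inv ve by (simp add: seen_by_def)
    moreover have "dot I ?x' p = dot I x p"
      using ep by (simp add: dot_move_left)
    moreover have "dot I ?x' e = t" by (simp add: dot_move_left ee)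
    ultimately show "ennreal (B ?x' * b (dot I ?x' J / sqrt ?N)) = ennreal (B x) * ennreal (b (dot I x y + \<sigma> * t))"
      using B01 b01 by (simp add: xJ re xy \<sigma>_def add_divide_distrib ennreal_mult)
  qed
  also have "\<dots> \<le> (\<integral>\<^sup>+x. ennreal q * ennreal (B x) + indicator ?A x \<partial>gauss I)"
  proof (intro nn_integral_mono)
    fix x assume x: "x \<in> space (gauss I)"
    have eq: "(\<integral>\<^sup>+t. ennreal (B x) * ennreal (b (dot I x y + \<sigma> * t)) \<partial>std_gaussian)
        = ennreal (B x) * (\<integral>\<^sup>+t. ennreal (b (dot I x y + \<sigma> * t)) \<partial>std_gaussian)"
      by (rule nn_integral_cmult) measurable
    show "(\<integral>\<^sup>+t. ennreal (B x) * ennreal (b (dot I x y + \<sigma> * t)) \<partial>std_gaussian) \<le> ennreal q * ennreal (B x) + indicator ?A x"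
    proof (cases "\<bar>dot I x y\<bar> \<le> R")
      case True
      have "ennreal (B x) * (\<integral>\<^sup>+t. ennreal (b (dot I x y + \<sigma> * t)) \<partial>std_gaussian) \<le> ennreal (B x) * ennreal q"
        using q[OF \<sigma> True] by (intro mult_left_mono) auto
      thus ?thesis unfolding eq using True by (simp add: mult.commute)
    next
      case False
      have "(\<integral>\<^sup>+t. ennreal (b (dot I x y + \<sigma> * t)) \<partial>std_gaussian) \<le> (\<integral>\<^sup>+t. 1 \<partial>std_gaussian)"
        using b01 by (intro nn_integral_mono) simp
      hence "ennreal (B x) * (\<integral>\<^sup>+t. ennreal (b (dot I x y + \<sigma> * t)) \<partial>std_gaussian) \<le> 1 * 1"
        using B01 by (intro mult_mono) (auto simp: std_gaussian.emeasure_space_1[simplified])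
      also have "1 * 1 \<le> ennreal q * ennreal (B x) + indicator ?A x"
        using False x by (simp add: add_increasing)
      finally show ?thesis unfolding eq .
    qed
  qed
  also have "\<dots> = ennreal q * (\<integral>\<^sup>+x. ennreal (B x) \<partial>gauss I) + emeasure (gauss I) ?A"
    by (subst nn_integral_add) (auto simp: nn_integral_cmult)
  also have "\<dots> \<le> ennreal q * (\<integral>\<^sup>+x. ennreal (B x) \<partial>gauss I) + ennreal (2 * exp (- R\<^sup>2 / (2 * \<epsilon>)))"
    using gauss_tail[OF fin yy \<epsilon>(1) R] by (intro add_left_mono)
  also have "(\<integral>\<^sup>+x. ennreal (B x) \<partial>gauss I) = ennreal (\<integral>x. B x \<partial>gauss I)"
    using B01 by (intro nn_integral_eq_integral gauss.integrable_const_bound[where B = 1]) auto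
  also have "(\<integral>\<^sup>+x. ennreal (B x * b (dot I x J / sqrt ?N)) \<partial>gauss I) = ennreal (\<integral>x. B x * b (dot I x J / sqrt ?N) \<partial>gauss I)"
    using B01 b01 by (intro nn_integral_eq_integral gauss.integrable_const_bound[where B = 1]) (auto intro!: mult_le_one simp: abs_mult)
  also have "ennreal q * ennreal (\<integral>x. B x \<partial>gauss I) + ennreal (2 * exp (- R\<^sup>2 / (2 * \<epsilon>)))
      = ennreal (q * (\<integral>x. B x \<partial>gauss I) + 2 * exp (- R\<^sup>2 / (2 * \<epsilon>)))"
    using \<open>q \<ge> 0\<close> B01 by (simp add: ennreal_mult integral_nonneg_AE)
  finally show "(\<integral>x. B x * b (dot I x J / sqrt (card I)) \<partial>gauss I) \<le> q * (\<integral>x. B x \<partial>gauss I) + 2 * exp (- R\<^sup>2 / (2 * \<epsilon>))"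
    using \<open>q \<ge> 0\<close> B01 by (subst (asm) ennreal_le_iff) (auto intro!: add_nonneg_nonneg mult_nonneg_nonneg integral_nonneg_AE)
qed

text \<open>
  Weights of density at most \<open>W\<close> with respect to the uniform measure put little mass on sign vectors
  with a large projection to a given subspace: by Markov's inequality with the exponential moment of
  the uniform measure, the loss \<open>W\<close> is beaten once \<open>exp (\<epsilon> N / 4)\<close> is large compared with \<open>W\<close> and the factor \<open>sqrt 2\<close> per
  dimension.
\<close>
lemma gibbs_bad_weight:
  fixes \<epsilon> :: real
  assumes fin: "finite I" and on: "orthonormal I k v" and W: "W \<ge> 0"
    and w: "\<And>J. J \<in> cube I \<Longrightarrow> 0 \<le> w J" "\<And>J. J \<in> cube I \<Longrightarrow> w J \<le> W / 2 ^ card I"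
  shows "(\<Sum>J\<in>cube I. if proj_sq I k v J \<le> \<epsilon> * card I then 0 else w J) \<le> W * exp (- \<epsilon> * card I / 4) * sqrt 2 ^ k"
proof -
  have "(\<Sum>J\<in>cube I. if proj_sq I k v J \<le> \<epsilon> * card I then 0 else w J)
      \<le> (\<Sum>J\<in>cube I. W / 2 ^ card I * exp (- \<epsilon> * card I / 4) * exp (proj_sq I k v J / 4))"
  proof (intro sum_mono)
    fix J assume J: "J \<in> cube I"
    have "w J * 1 \<le> W / 2 ^ card I * exp (- \<epsilon> * card I / 4 + proj_sq I k v J / 4)" if "\<epsilon> * card I < proj_sq I k v J"
      using w[OF J] W that by (intro mult_mono) auto
    thus "(if proj_sq I k v J \<le> \<epsilon> * card I then 0 else w J)
        \<le> W / 2 ^ card I * exp (- \<epsilon> * card I / 4) * exp (proj_sq I k v J / 4)"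
      using W by (auto simp: mult.assoc simp flip: exp_add)
  qed
  also have "\<dots> = W / 2 ^ card I * exp (- \<epsilon> * card I / 4) * (\<Sum>J\<in>cube I. exp (proj_sq I k v J / 4))"
    by (simp add: sum_distrib_left)
  also have "\<dots> \<le> W / 2 ^ card I * exp (- \<epsilon> * card I / 4) * (2 ^ card I * sqrt 2 ^ k)"
    using cube_exp_proj_sq_le[OF fin on] W by (intro mult_left_mono) auto
  finally show ?thesis by (simp add: mult_ac)
qed

lemma dot_cube_self: "J \<in> cube I \<Longrightarrow> dot I J J = real (card I)"
proof -
  assume J: "J \<in> cube I"
  have "J i * J i = 1" if "i \<in> I" for i using J that by (auto simp: PiE_iff)
  thus ?thesis by (simp add: dot_def)
qed

text \<open>
  The \<open>j\<close>-th power of the average of \<open>b\<close> over the weights is a probability for \<open>j\<close> independent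
  samples (replicas) of \<open>w\<close>. Multiplying out one factor at a time, each sample \<open>J\<close> is absorbed
  into \<open>B\<close>. If \<open>J\<close> is mostly orthogonal to the vectors seen so far, \<open>fresh_direction\<close> gains a factor
  \<open>q\<close>; the others have total weight bounded by \<open>gibbs_bad_weight\<close>. Stating the claim for all \<open>B\<close> seen by
  \<open>k\<close> vectors, with \<open>k + j \<le> n\<close>, avoids sums over \<open>n\<close>-tuples of sign vectors.
\<close>
lemma replica_recursion:
  fixes b :: "real \<Rightarrow> real" and w :: "('i \<Rightarrow> real) \<Rightarrow> real"
  assumes fin: "finite I" and N: "card I > 0"
    and \<epsilon>: "0 < \<epsilon>" "\<epsilon> \<le> 1 / 2" and R: "R \<ge> 0"
    and b [measurable]: "b \<in> borel_measurable borel" and b01: "\<And>x. 0 \<le> b x" "\<And>x. b x \<le> 1"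
    and q: "\<And>m \<sigma>. \<lbrakk>\<sigma> > 0; 1 / 2 \<le> \<sigma>\<^sup>2; \<sigma>\<^sup>2 \<le> 1; \<bar>m\<bar> \<le> R\<rbrakk> \<Longrightarrow> (\<integral>\<^sup>+t. ennreal (b (m + \<sigma> * t)) \<partial>std_gaussian) \<le> ennreal q"
    and q01: "0 \<le> q" "q \<le> 1"
    and W: "W \<ge> 0" and w: "\<And>J. J \<in> cube I \<Longrightarrow> 0 \<le> w J" "\<And>J. J \<in> cube I \<Longrightarrow> w J \<le> W / 2 ^ card I"
    and w1: "(\<Sum>J\<in>cube I. w J) = 1"
    and B [measurable]: "B \<in> borel_measurable (gauss I)" and B01: "\<And>x. 0 \<le> B x" "\<And>x. B x \<le> 1"
    and on: "orthonormal I k v" and inv: "seen_by I k v B" and kj: "k + j \<le> n"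
  shows "(\<integral>x. B x * (\<Sum>J\<in>cube I. w J * b (dot I x J / sqrt (card I))) ^ j \<partial>gauss I)
    \<le> q ^ j * (\<integral>x. B x \<partial>gauss I) + real j * (2 * exp (- R\<^sup>2 / (2 * \<epsilon>)) + W * exp (- \<epsilon> * card I / 4) * sqrt 2 ^ n)"
  using B B01 on inv kj
proof (induction j arbitrary: k v B)
  case 0
  show ?case by simp
next
  case (Suc j k v B)
  note [measurable] = Suc.prems(1)
  note B01 = Suc.prems(2,3)
  note on = Suc.prems(4)
  define \<beta> where "\<beta> J x = b (dot I x J / sqrt (card I))" for J x
  have \<beta>01: "0 \<le> \<beta> J x" "\<beta> J x \<le> 1" for J x using b01 by (auto simp: \<beta>_def)
  have [measurable]: "\<beta> J \<in> borel_measurable (gauss I)" for J unfolding \<beta>_def by measurable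
  define P where "P x = (\<Sum>J\<in>cube I. w J * \<beta> J x)" for x
  have P0: "P x \<ge> 0" for x unfolding P_def using w \<beta>01 by (intro sum_nonneg mult_nonneg_nonneg) auto
  have P1: "P x \<le> 1" for x
  proof -
    have "P x \<le> (\<Sum>J\<in>cube I. w J * 1)" unfolding P_def using w \<beta>01 by (intro sum_mono mult_left_mono) auto
    thus ?thesis using w1 by simp
  qed
  have [measurable]: "P \<in> borel_measurable (gauss I)" unfolding P_def by measurable
  define \<rho> where "\<rho> = 2 * exp (- R\<^sup>2 / (2 * \<epsilon>))"
  define \<delta> where "\<delta> = W * exp (- \<epsilon> * card I / 4) * sqrt 2 ^ n"
  have \<rho>\<delta>: "\<rho> \<ge> 0" "\<delta> \<ge> 0" using W by (auto simp: \<rho>_def \<delta>_def)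
  have bnd: "integrable (gauss I) f" if "f \<in> borel_measurable (gauss I)" "\<And>x. 0 \<le> f x" "\<And>x. f x \<le> 1" for f :: "_ \<Rightarrow> real"
    using that by (intro gauss.integrable_const_bound[where B = 1]) auto
  have le1: "B x * \<beta> J x \<le> 1" "B x * \<beta> J x * P x ^ j \<le> 1" "0 \<le> B x * \<beta> J x" "0 \<le> B x * \<beta> J x * P x ^ j" for x J
    using B01 \<beta>01 P0 P1 by (auto intro!: mult_le_one power_le_one)
  have intB: "0 \<le> (\<integral>x. B x \<partial>gauss I)" using B01 by (intro integral_nonneg_AE) auto
  have step: "(\<integral>x. B x * \<beta> J x * P x ^ j \<partial>gauss I)
     \<le> q ^ Suc j * (\<integral>x. B x \<partial>gauss I) + \<rho> + real j * (\<rho> + \<delta>)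
        + (if proj_sq I k v J \<le> \<epsilon> * card I then 0 else 1)" if J: "J \<in> cube I" for J
  proof (cases "proj_sq I k v J \<le> \<epsilon> * card I")
    case True
    obtain v' where v': "orthonormal I (Suc k) v'" "seen_by I (Suc k) v' (\<lambda>x. B x * \<beta> J x)"
      using fresh_direction(1)[OF fin N on dot_cube_self[OF J] True \<epsilon> R b b01 q q01(1) Suc.prems(1-3,5)]
      unfolding \<beta>_def by blast
    have "(\<integral>x. B x * \<beta> J x * P x ^ j \<partial>gauss I)
        \<le> q ^ j * (\<integral>x. B x * \<beta> J x \<partial>gauss I) + real j * (\<rho> + \<delta>)"
      unfolding P_def \<beta>_def \<rho>_def \<delta>_def
      by (rule Suc.IH[where k = "Suc k" and v = v'])
         (use v' le1 Suc.prems(6) in \<open>auto simp: \<beta>_def\<close>)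
    also have "q ^ j * (\<integral>x. B x * \<beta> J x \<partial>gauss I) \<le> q ^ j * (q * (\<integral>x. B x \<partial>gauss I) + \<rho>)"
      using fresh_direction(2)[OF fin N on dot_cube_self[OF J] True \<epsilon> R b b01 q q01(1) Suc.prems(1-3,5)] q01
      unfolding \<beta>_def \<rho>_def by (intro mult_left_mono) auto
    also have "\<dots> \<le> q ^ Suc j * (\<integral>x. B x \<partial>gauss I) + \<rho>"
    proof -
      have "q ^ j * \<rho> \<le> 1 * \<rho>"
        using q01 \<rho>\<delta> by (intro mult_right_mono power_le_one) auto
      thus ?thesis by (simp add: distrib_left mult.assoc mult.left_commute)
    qed
    finally show ?thesis using True by simp
  next
    case False
    have "(\<integral>x. B x * \<beta> J x * P x ^ j \<partial>gauss I) \<le> (\<integral>x. 1 \<partial>gauss I)"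
      using le1 by (intro integral_mono bnd) auto
    also have "\<dots> = 1"
      by (simp add: gauss.prob_space)
    also have "1 \<le> q ^ Suc j * (\<integral>x. B x \<partial>gauss I) + \<rho> + real j * (\<rho> + \<delta>) + 1"
    proof -
      have "0 \<le> q ^ Suc j * (\<integral>x. B x \<partial>gauss I)" "0 \<le> real j * (\<rho> + \<delta>)"
        using q01 intB \<rho>\<delta> by (simp_all only: mult_nonneg_nonneg zero_le_power of_nat_0_le_iff add_nonneg_nonneg)
      thus ?thesis using \<rho>\<delta> by linarith
    qed
    finally show ?thesis using False by simp
  qed
  have "(\<integral>x. B x * P x ^ Suc j \<partial>gauss I) = (\<integral>x. (\<Sum>J\<in>cube I. w J * (B x * \<beta> J x * P x ^ j)) \<partial>gauss I)"
  proof (intro Bochner_Integration.integral_cong refl)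
    fix x
    have "B x * P x ^ Suc j = (\<Sum>J\<in>cube I. w J * \<beta> J x) * (B x * P x ^ j)"
      by (simp add: P_def[symmetric])
    also have "\<dots> = (\<Sum>J\<in>cube I. w J * (B x * \<beta> J x * P x ^ j))"
      unfolding sum_distrib_right by (simp only: mult_ac)
    finally show "B x * P x ^ Suc j = (\<Sum>J\<in>cube I. w J * (B x * \<beta> J x * P x ^ j))" .
  qed
  also have "\<dots> = (\<Sum>J\<in>cube I. w J * (\<integral>x. B x * \<beta> J x * P x ^ j \<partial>gauss I))"
    using le1 by (subst Bochner_Integration.integral_sum) (auto intro!: integrable_mult_right bnd)
  also have "\<dots> \<le> (\<Sum>J\<in>cube I. w J * (q ^ Suc j * (\<integral>x. B x \<partial>gauss I) + \<rho> + real j * (\<rho> + \<delta>)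
        + (if proj_sq I k v J \<le> \<epsilon> * card I then 0 else 1)))"
    using step w by (intro sum_mono mult_left_mono) auto
  also have "\<dots> = (\<Sum>J\<in>cube I. w J * (q ^ Suc j * (\<integral>x. B x \<partial>gauss I) + \<rho> + real j * (\<rho> + \<delta>))
        + (if proj_sq I k v J \<le> \<epsilon> * card I then 0 else w J))"
    by (intro sum.cong) (auto simp: algebra_simps)
  also have "\<dots> = q ^ Suc j * (\<integral>x. B x \<partial>gauss I) + \<rho> + real j * (\<rho> + \<delta>)
        + (\<Sum>J\<in>cube I. if proj_sq I k v J \<le> \<epsilon> * card I then 0 else w J)"
    unfolding sum.distrib sum_distrib_right[symmetric] w1 by simp
  also have "(\<Sum>J\<in>cube I. if proj_sq I k v J \<le> \<epsilon> * card I then 0 else w J) \<le> \<delta>"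
  proof -
    have "(\<Sum>J\<in>cube I. if proj_sq I k v J \<le> \<epsilon> * card I then 0 else w J) \<le> W * exp (- \<epsilon> * card I / 4) * sqrt 2 ^ k"
      by (rule gibbs_bad_weight[OF fin on W w]) auto
    also have "\<dots> \<le> \<delta>"
      unfolding \<delta>_def using W Suc.prems(6) by (intro mult_left_mono power_increasing) auto
    finally show ?thesis .
  qed
  also have "q ^ Suc j * (\<integral>x. B x \<partial>gauss I) + \<rho> + real j * (\<rho> + \<delta>) + \<delta>
      = q ^ Suc j * (\<integral>x. B x \<partial>gauss I) + real (Suc j) * (\<rho> + \<delta>)"
    by (simp add: algebra_simps)
  finally have "(\<integral>x. B x * P x ^ Suc j \<partial>gauss I)
      \<le> q ^ Suc j * (\<integral>x. B x \<partial>gauss I) + real (Suc j) * (\<rho> + \<delta>)"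
    by simp
  thus ?case
    unfolding P_def \<beta>_def \<rho>_def \<delta>_def .
qed

text \<open>
  If the Gibbs average of \<open>U\<close> is below \<open>1 / n\<close>, then \<open>n\<close> replicas all fail with probability at least
  \<open>(1 - 1 / n) ^ n\<close>, which is bounded below. So the probability of a small average is, up to a
  constant, at most the probability that \<open>n\<close> replicas fail.
\<close>
lemma gibbs_average_small_probability:
  fixes U :: "real \<Rightarrow> real" and w :: "('i \<Rightarrow> real) \<Rightarrow> real"
  assumes fin: "finite I" and N: "card I > 0"
    and \<epsilon>: "0 < \<epsilon>" "\<epsilon> \<le> 1 / 2" and R: "R \<ge> 0"
    and U [measurable]: "U \<in> borel_measurable borel" and U01: "\<And>x. 0 \<le> U x" "\<And>x. U x \<le> 1"
    and E: "E \<in> sets borel" "E \<subseteq> {-K..K}" and hit: "\<And>x. x \<in> E \<Longrightarrow> \<delta> \<le> U x" and "\<delta> > 0"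
    and vol: "vol \<le> measure lborel E"
    and W: "W \<ge> 0" and w: "\<And>J. J \<in> cube I \<Longrightarrow> 0 \<le> w J" "\<And>J. J \<in> cube I \<Longrightarrow> w J \<le> W / 2 ^ card I"
    and w1: "(\<Sum>J\<in>cube I. w J) = 1"
    and n: "n \<ge> 2" and vol0: "vol \<ge> 0"
  shows "measure (gauss I) {x \<in> space (gauss I). (\<Sum>J\<in>cube I. w J * U (dot I x J / sqrt (card I))) < 1 / real n}
    \<le> 9 * (exp (- (real n * (\<delta> / sqrt (2 * pi) * exp (- (K + R)\<^sup>2) * vol)))
       + real n * (2 * exp (- R\<^sup>2 / (2 * \<epsilon>)) + W * exp (- \<epsilon> * card I / 4) * sqrt 2 ^ n))"
proof -
  define \<kappa> where "\<kappa> = \<delta> / sqrt (2 * pi) * exp (- (K + R)\<^sup>2) * measure lborel E"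
  define q where "q = max 0 (1 - \<kappa>)"
  have "\<kappa> \<ge> 0" using \<open>\<delta> > 0\<close> by (simp add: \<kappa>_def)
  hence q01: "0 \<le> q" "q \<le> 1" by (auto simp: q_def)
  have q: "(\<integral>\<^sup>+t. ennreal (1 - U (m + \<sigma> * t)) \<partial>std_gaussian) \<le> ennreal q"
    if "\<sigma> > 0" "1 / 2 \<le> \<sigma>\<^sup>2" "\<sigma>\<^sup>2 \<le> 1" "\<bar>m\<bar> \<le> R" for m \<sigma>
  proof -
    have "(\<integral>\<^sup>+t. ennreal (1 - U (m + \<sigma> * t)) \<partial>std_gaussian) \<le> ennreal (1 - \<kappa>)"
      unfolding \<kappa>_def using that by (intro gauss_miss_probability_le[OF U U01 E hit \<open>\<delta> > 0\<close>])
    also have "\<dots> \<le> ennreal q" by (intro ennreal_leI) (simp add: q_def)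
    finally show ?thesis .
  qed
  define p where "p x = (\<Sum>J\<in>cube I. w J * U (dot I x J / sqrt (card I)))" for x
  define P where "P x = (\<Sum>J\<in>cube I. w J * (1 - U (dot I x J / sqrt (card I))))" for x
  have Pp: "P x = 1 - p x" for x
    by (simp add: P_def p_def algebra_simps sum_subtractf w1)
  have p0: "p x \<ge> 0" for x unfolding p_def using w U01 by (intro sum_nonneg mult_nonneg_nonneg) auto
  have P0: "P x \<ge> 0" for x unfolding P_def using w U01 by (intro sum_nonneg mult_nonneg_nonneg) auto
  have [measurable]: "P \<in> borel_measurable (gauss I)" "p \<in> borel_measurable (gauss I)"
    unfolding P_def p_def by measurable
  let ?A = "{x \<in> space (gauss I). p x < 1 / real n}"
  \<comment> \<open>from \<open>1 - y \<ge> exp (- 2 * y)\<close> for \<open>y \<le> 1 / 2\<close>\<close>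
  have ninth: "1 / 9 \<le> (1 - 1 / real n) ^ n"
  proof -
    have "- (1 / real n) - 2 * (1 / real n)\<^sup>2 \<le> ln (1 - 1 / real n)"
      using n by (intro ln_one_minus_pos_lower_bound) auto
    moreover have "(1 / real n)\<^sup>2 \<le> 1 / 2 * (1 / real n)"
      unfolding power2_eq_square using n by (intro mult_right_mono) auto
    ultimately have "- 2 / real n \<le> ln (1 - 1 / real n)" by simp
    hence "real n * (- 2 / real n) \<le> real n * ln (1 - 1 / real n)" by (intro mult_left_mono) auto
    hence "exp (- 2) \<le> exp (real n * ln (1 - 1 / real n))" using n by simp
    also have "\<dots> = (1 - 1 / real n) ^ n" using n by (simp add: exp_of_nat_mult)
    finally have "exp (- 2) \<le> (1 - 1 / real n) ^ n" .
    moreover have "exp (2 :: real) \<le> 9"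
    proof -
      have "exp (2 :: real) = exp 1 * exp 1" by (simp flip: exp_add)
      also have "\<dots> \<le> 3 * 3" by (intro mult_mono exp_le) auto
      finally show ?thesis by simp
    qed
    hence "1 / 9 \<le> exp (- 2 :: real)" by (simp add: exp_minus field_simps)
    ultimately show ?thesis by linarith
  qed
  have "1 / 9 * measure (gauss I) ?A = (\<integral>x. 1 / 9 * indicator ?A x \<partial>gauss I)"
    by simp
  also have "\<dots> \<le> (\<integral>x. P x ^ n \<partial>gauss I)"
  proof (intro integral_mono)
    show "integrable (gauss I) (\<lambda>x. 1 / 9 * indicator ?A x :: real)"
      by (intro gauss.integrable_const_bound[where B = 1]) (auto simp: indicator_def)
    show "integrable (gauss I) (\<lambda>x. P x ^ n)"
      using P0 p0 by (intro gauss.integrable_const_bound[where B = 1]) (auto intro!: power_le_one simp: Pp)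
    fix x
    show "1 / 9 * indicator ?A x \<le> P x ^ n"
    proof (cases "x \<in> ?A")
      case True
      have "(1 - 1 / real n) ^ n \<le> P x ^ n"
        using True n by (intro power_mono) (auto simp: Pp)
      thus ?thesis using True ninth by simp
    qed (use P0 in simp)
  qed
  also have "(\<integral>x. P x ^ n \<partial>gauss I) = (\<integral>x. 1 * (\<Sum>J\<in>cube I. w J * (1 - U (dot I x J / sqrt (card I)))) ^ n \<partial>gauss I)"
    by (simp add: P_def)
  also have "\<dots> \<le> q ^ n * (\<integral>x. 1 \<partial>gauss I) + real n * (2 * exp (- R\<^sup>2 / (2 * \<epsilon>)) + W * exp (- \<epsilon> * card I / 4) * sqrt 2 ^ n)"
    by (rule replica_recursion[where k = 0 and v = "\<lambda>_ _. 0", OF fin N \<epsilon> R _ _ _ q q01 W w w1])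
       (use U01 in \<open>auto simp: orthonormal_def seen_by_def\<close>)
  also have "q ^ n * (\<integral>x. 1 \<partial>gauss I) \<le> exp (- (real n * (\<delta> / sqrt (2 * pi) * exp (- (K + R)\<^sup>2) * vol)))"
  proof -
    have "q \<le> exp (- \<kappa>)" using exp_ge_add_one_self[of "- \<kappa>"] by (auto simp: q_def)
    hence "q ^ n \<le> exp (- \<kappa>) ^ n" using q01 by (intro power_mono)
    also have "\<dots> = exp (- (real n * \<kappa>))" by (simp flip: exp_of_nat_mult)
    also have "\<dots> \<le> exp (- (real n * (\<delta> / sqrt (2 * pi) * exp (- (K + R)\<^sup>2) * vol)))"
      using vol \<open>\<delta> > 0\<close> by (auto simp: \<kappa>_def intro!: divide_right_mono mult_left_mono)
    finally show ?thesis by (simp add: gauss.prob_space)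
  qed
  finally show ?thesis by (simp add: p_def)
qed

section \<open>Concentration for functions of independent blocks\<close>

text \<open>
  Hoeffding's lemma for both signs of the parameter.
\<close>
lemma (in prob_space) mgf_centered_le:
  fixes X :: "'a \<Rightarrow> real" and l c :: real
  assumes [measurable]: "X \<in> borel_measurable M" and X: "\<And>x. x \<in> space M \<Longrightarrow> 0 \<le> X x" "\<And>x. x \<in> space M \<Longrightarrow> X x \<le> c"
  shows "(\<integral>x. exp (l * (expectation X - X x)) \<partial>M) \<le> exp (l\<^sup>2 * c\<^sup>2 / 8)"
proof -
  have le: "(\<integral>x. exp (l * (Y x - expectation Y)) \<partial>M) \<le> exp (l\<^sup>2 * c\<^sup>2 / 8)"
    if [measurable]: "Y \<in> borel_measurable M" and Y: "\<And>x. x \<in> space M \<Longrightarrow> Y x \<in> {a..a + c}" and l: "l > 0" for Y a and l :: real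
  proof -
    interpret Y: interval_bounded_random_variable M Y a "a + c"
      by standard (use Y in auto)
    have "\<And>x. x \<in> space M \<Longrightarrow> \<bar>Y x - expectation Y\<bar> \<le> \<bar>a\<bar> + \<bar>a + c\<bar> + \<bar>expectation Y\<bar>"
      using Y by fastforce
    hence b: "\<And>x. x \<in> space M \<Longrightarrow> l * (Y x - expectation Y) \<le> l * (\<bar>a\<bar> + \<bar>a + c\<bar> + \<bar>expectation Y\<bar>)"
      using l by (intro mult_left_mono) (auto simp: abs_le_iff)
    have int: "integrable M (\<lambda>x. exp (l * (Y x - expectation Y)))"
      by (rule integrable_const_bound[where B = "exp (l * (\<bar>a\<bar> + \<bar>a + c\<bar> + \<bar>expectation Y\<bar>))"])
         (use b in auto)
    have "ennreal (\<integral>x. exp (l * (Y x - expectation Y)) \<partial>M) = (\<integral>\<^sup>+x. exp (l * (Y x - expectation Y)) \<partial>M)"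
      by (rule nn_integral_eq_integral[symmetric]) (use int in auto)
    also have "\<dots> \<le> ennreal (exp (l\<^sup>2 * (a + c - a)\<^sup>2 / 8))"
      by (rule Y.Hoeffdings_lemma_nn_integral[OF l])
    finally show ?thesis by (simp add: ennreal_le_iff)
  qed
  consider "l = 0" | "l > 0" | "l < 0" by linarith
  thus ?thesis
  proof cases
    case 1
    thus ?thesis by (simp add: prob_space)
  next
    case 2
    show ?thesis using le[of "\<lambda>x. - X x" "- c" l] X 2 by (simp add: algebra_simps)
  next
    case 3
    show ?thesis using le[of X 0 "- l"] X 3 by (simp add: algebra_simps)
  qed
qed

text \<open>
  A function of independent blocks, with a comparison function \<open>H a\<close> for each block \<open>a\<close> that does
  not depend on that block and dominates \<open>F\<close>. The martingale increments of \<open>F\<close> are also those of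
  \<open>F - H a\<close>. If \<open>H a - F\<close> were at most \<open>c\<close>, Azuma's inequality would apply; here it exceeds \<open>c\<close> by
  at most \<open>\<eta>\<close> on average. Truncating the increments at \<open>c\<close> gives \<open>D\<close>, which has the Gaussian moment
  generating function of a martingale with increments in intervals of length \<open>c\<close>, and the
  truncation costs \<open>2 \<eta>\<close> per block in mean absolute value.

  The induction integrates out the last block. The mean excess over \<open>c\<close>, unlike its probability,
  passes to the integrated functions because \<open>max 0\<close> is convex.
\<close>
lemma block_martingale_approximation:
  fixes Mi :: "'i \<Rightarrow> 'a measure" and B :: "nat \<Rightarrow> 'i set" and F :: "('i \<Rightarrow> 'a) \<Rightarrow> real" and H :: "nat \<Rightarrow> ('i \<Rightarrow> 'a) \<Rightarrow> real"
  assumes P: "\<And>i. prob_space (Mi i)" and finB: "\<And>a. finite (B a)" and disj: "\<And>a a'. a \<noteq> a' \<Longrightarrow> B a \<inter> B a' = {}"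
    and c: "c \<ge> 0"
  defines "I \<equiv> \<lambda>m. (\<Union>a<m. B a)"
  defines "\<Omega> \<equiv> \<lambda>m. PiM (I m) Mi"
  assumes F: "F \<in> borel_measurable (\<Omega> m)" "\<And>x. x \<in> space (\<Omega> m) \<Longrightarrow> \<bar>F x\<bar> \<le> K"
    and H: "\<And>a. a < m \<Longrightarrow> H a \<in> borel_measurable (\<Omega> m)" "\<And>a x. a < m \<Longrightarrow> x \<in> space (\<Omega> m) \<Longrightarrow> \<bar>H a x\<bar> \<le> K"
    and FH: "\<And>a x. a < m \<Longrightarrow> x \<in> space (\<Omega> m) \<Longrightarrow> F x \<le> H a x"
    and Hind: "\<And>a x y. a < m \<Longrightarrow> x \<in> space (\<Omega> m) \<Longrightarrow> y \<in> space (\<Omega> m) \<Longrightarrow> (\<forall>i\<in>I m - B a. x i = y i) \<Longrightarrow> H a x = H a y"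
    and excess: "\<And>a. a < m \<Longrightarrow> (\<integral>x. max 0 (H a x - F x - c) \<partial>\<Omega> m) \<le> \<eta>"
  shows "\<exists>D C. D \<in> borel_measurable (\<Omega> m) \<and> (\<forall>x\<in>space (\<Omega> m). \<bar>D x\<bar> \<le> C)
    \<and> (\<forall>l. (\<integral>x. exp (l * D x) \<partial>\<Omega> m) \<le> exp (real m * l\<^sup>2 * c\<^sup>2 / 8))
    \<and> (\<integral>x. \<bar>F x - (\<integral>y. F y \<partial>\<Omega> m) - D x\<bar> \<partial>\<Omega> m) \<le> 2 * real m * \<eta>"
  using F H FH Hind excess
proof (induction m arbitrary: F H)
  case 0
  interpret prob_space "\<Omega> 0" unfolding \<Omega>_def using P by (rule prob_space_PiM)
  have sp: "space (\<Omega> 0) = {\<lambda>_. undefined}" by (simp add: \<Omega>_def I_def space_PiM)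
  have pr: "prob {\<lambda>_. undefined} = 1" using prob_space by (simp add: sp)
  have "(\<integral>y. F y \<partial>\<Omega> 0) = (\<integral>y. F (\<lambda>_. undefined) \<partial>\<Omega> 0)"
    by (intro Bochner_Integration.integral_cong) (auto simp: sp)
  hence "(\<integral>x. \<bar>F x - (\<integral>y. F y \<partial>\<Omega> 0)\<bar> \<partial>\<Omega> 0) = (\<integral>x. 0 \<partial>\<Omega> 0)"
    by (intro Bochner_Integration.integral_cong) (auto simp: sp pr)
  thus ?case by (intro exI[of _ "\<lambda>_. 0"] exI[of _ 0]) (simp add: sp pr)
next
  case (Suc m F H)
  note F = Suc.prems(1,2) and H = Suc.prems(3,4) and FH = Suc.prems(5) and Hind = Suc.prems(6) and excess = Suc.prems(7)
  define J where "J = B m"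
  define \<Omega>J where "\<Omega>J = PiM J Mi"
  define mg where "mg x y = merge (I m) J (x, y)" for x y :: "'i \<Rightarrow> 'a"
  interpret product_sigma_finite Mi
    by (rule product_sigma_finite.intro) (rule prob_space_imp_sigma_finite[OF P])
  interpret S: prob_space "\<Omega> (Suc m)" unfolding \<Omega>_def using P by (rule prob_space_PiM)
  interpret X: prob_space "\<Omega> m" unfolding \<Omega>_def using P by (rule prob_space_PiM)
  interpret Y: prob_space \<Omega>J unfolding \<Omega>J_def using P by (rule prob_space_PiM)
  have IJ: "I (Suc m) = I m \<union> J" by (auto simp: I_def J_def lessThan_Suc)
  have dj: "I m \<inter> J = {}"
  proof -
    have "B a \<inter> B m = {}" if "a < m" for a using disj[of a m] that by simp
    thus ?thesis by (auto simp: I_def J_def)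
  qed
  have fin: "finite (I m)" "finite J" using finB by (auto simp: I_def J_def)
  have \<Omega>S: "\<Omega> (Suc m) = PiM (I m \<union> J) Mi" by (simp add: \<Omega>_def IJ)
  have mgm: "(\<lambda>p. mg (fst p) (snd p)) \<in> measurable (\<Omega> m \<Otimes>\<^sub>M \<Omega>J) (\<Omega> (Suc m))"
    unfolding mg_def \<Omega>S by (simp add: \<Omega>_def \<Omega>J_def measurable_merge)
  have mgm2 [measurable]: "mg x \<in> measurable \<Omega>J (\<Omega> (Suc m))" if "x \<in> space (\<Omega> m)" for x
    using measurable_compose[OF measurable_Pair1'[OF that] mgm] by simp
  have mgs: "mg x y \<in> space (\<Omega> (Suc m))" if "x \<in> space (\<Omega> m)" "y \<in> space \<Omega>J" for x y
    using measurable_space[OF mgm2[OF that(1)] that(2)] .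
  have pairm: "(\<lambda>p. g (mg (fst p) (snd p))) \<in> borel_measurable (\<Omega> m \<Otimes>\<^sub>M \<Omega>J)"
    if "g \<in> borel_measurable (\<Omega> (Suc m))" for g :: "_ \<Rightarrow> real"
    using measurable_compose[OF mgm that] .
  have int1 [measurable]: "(\<lambda>x. \<integral>y. g (mg x y) \<partial>\<Omega>J) \<in> borel_measurable (\<Omega> m)"
    if "g \<in> borel_measurable (\<Omega> (Suc m))" for g :: "_ \<Rightarrow> real"
    using Y.borel_measurable_lebesgue_integral[of "\<lambda>x y. g (mg x y)" "\<Omega> m"] pairm[OF that]
    by (simp add: case_prod_beta')
  have intY: "integrable \<Omega>J (\<lambda>y. g (mg x y))"
    if "x \<in> space (\<Omega> m)" "g \<in> borel_measurable (\<Omega> (Suc m))" "\<And>z. z \<in> space (\<Omega> (Suc m)) \<Longrightarrow> \<bar>g z\<bar> \<le> C" for x g and C :: real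
    using that mgs by (intro Y.integrable_const_bound[where B = C]) (auto intro: measurable_compose[OF mgm2])
  have absY: "\<bar>\<integral>y. g (mg x y) \<partial>\<Omega>J\<bar> \<le> C"
    if "x \<in> space (\<Omega> m)" "g \<in> borel_measurable (\<Omega> (Suc m))" "\<And>z. z \<in> space (\<Omega> (Suc m)) \<Longrightarrow> \<bar>g z\<bar> \<le> C" for x g and C :: real
  proof -
    have "\<bar>\<integral>y. g (mg x y) \<partial>\<Omega>J\<bar> \<le> (\<integral>y. \<bar>g (mg x y)\<bar> \<partial>\<Omega>J)" by (rule integral_abs_bound)
    also have "\<dots> \<le> (\<integral>y. C \<partial>\<Omega>J)"
      using that mgs by (intro integral_mono integrable_abs intY) auto
    finally show ?thesis by (simp add: Y.prob_space)
  qed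
  have intX: "integrable (\<Omega> m) (\<lambda>x. \<integral>y. g (mg x y) \<partial>\<Omega>J)"
    if "g \<in> borel_measurable (\<Omega> (Suc m))" "\<And>z. z \<in> space (\<Omega> (Suc m)) \<Longrightarrow> \<bar>g z\<bar> \<le> C" for g and C :: real
    by (rule X.integrable_const_bound[where B = C, OF AE_I2]) (use that absY in \<open>auto simp: int1\<close>)
  have fold: "(\<integral>z. g z \<partial>\<Omega> (Suc m)) = (\<integral>x. (\<integral>y. g (mg x y) \<partial>\<Omega>J) \<partial>\<Omega> m)"
    if "g \<in> borel_measurable (\<Omega> (Suc m))" "\<And>z. z \<in> space (\<Omega> (Suc m)) \<Longrightarrow> \<bar>g z\<bar> \<le> C" for g and C :: real
  proof -
    have "integrable (\<Omega> (Suc m)) g" using that by (intro S.integrable_const_bound[where B = C]) auto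
    thus ?thesis unfolding \<Omega>S mg_def \<Omega>J_def
      using product_integral_fold[OF dj fin] by (simp add: \<Omega>_def)
  qed
  \<comment> \<open>The induction hypothesis is applied to the averages of all functions over the last block.\<close>
  define f where "f x = (\<integral>y. F (mg x y) \<partial>\<Omega>J)" for x
  define h where "h a x = (\<integral>y. H a (mg x y) \<partial>\<Omega>J)" for a x
  have [measurable]: "f \<in> borel_measurable (\<Omega> m)" unfolding f_def using F by (intro int1)
  have hF: "(\<lambda>z. max 0 (H a z - F z - c)) \<in> borel_measurable (\<Omega> (Suc m))" if "a < Suc m" for a
    using H(1)[OF that] F(1) by measurable
  have bF: "\<bar>max 0 (H a z - F z - c)\<bar> \<le> 2 * K + c" if "a < Suc m" "z \<in> space (\<Omega> (Suc m))" for a z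
    using H(2)[OF that] F(2)[OF that(2)] FH[OF that] c by auto
  have "\<exists>D C. D \<in> borel_measurable (\<Omega> m) \<and> (\<forall>x\<in>space (\<Omega> m). \<bar>D x\<bar> \<le> C)
    \<and> (\<forall>l. (\<integral>x. exp (l * D x) \<partial>\<Omega> m) \<le> exp (real m * l\<^sup>2 * c\<^sup>2 / 8))
    \<and> (\<integral>x. \<bar>f x - (\<integral>y. f y \<partial>\<Omega> m) - D x\<bar> \<partial>\<Omega> m) \<le> 2 * real m * \<eta>"
  proof (rule Suc.IH[of f h])
    show "f \<in> borel_measurable (\<Omega> m)" by measurable
    show "\<bar>f x\<bar> \<le> K" if "x \<in> space (\<Omega> m)" for x
      unfolding f_def using that F by (intro absY)
    fix a assume a: "a < m"
    hence a': "a < Suc m" by simp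
    show "h a \<in> borel_measurable (\<Omega> m)" unfolding h_def using H(1)[OF a'] by (intro int1)
    show "\<bar>h a x\<bar> \<le> K" if "x \<in> space (\<Omega> m)" for x
      unfolding h_def using that H[OF a'] by (intro absY)
    show "f x \<le> h a x" if "x \<in> space (\<Omega> m)" for x
      unfolding h_def f_def using that F H[OF a'] FH[OF a'] mgs by (intro integral_mono intY) auto
    show "h a x = h a x'" if x: "x \<in> space (\<Omega> m)" "x' \<in> space (\<Omega> m)" "\<forall>i\<in>I m - B a. x i = x' i" for x x'
      unfolding h_def
    proof (intro Bochner_Integration.integral_cong refl Hind[OF a'] mgs x)
      fix y
      show "\<forall>i\<in>I (Suc m) - B a. mg x y i = mg x' y i"
        using x(3) dj by (auto simp: mg_def merge_def IJ)
    qed auto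
    have "(\<integral>x. max 0 (h a x - f x - c) \<partial>\<Omega> m) \<le> (\<integral>x. (\<integral>y. max 0 (H a (mg x y) - F (mg x y) - c) \<partial>\<Omega>J) \<partial>\<Omega> m)"
    proof (intro integral_mono)
      show "integrable (\<Omega> m) (\<lambda>x. \<integral>y. max 0 (H a (mg x y) - F (mg x y) - c) \<partial>\<Omega>J)"
        using hF[OF a'] bF[OF a'] by (intro intX[of "\<lambda>z. max 0 (H a z - F z - c)"])
      have hm: "h a \<in> borel_measurable (\<Omega> m)" unfolding h_def using H(1)[OF a'] by (intro int1)
      have "\<bar>h a x\<bar> \<le> K" "\<bar>f x\<bar> \<le> K" if "x \<in> space (\<Omega> m)" for x
        unfolding h_def f_def using that H[OF a'] F by (auto intro!: absY)
      thus "integrable (\<Omega> m) (\<lambda>x. max 0 (h a x - f x - c))"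
        using hm c by (intro X.integrable_const_bound[where B = "2 * K + c"] AE_I2) (fastforce simp: abs_le_iff)+
      fix x assume x: "x \<in> space (\<Omega> m)"
      have i1: "integrable \<Omega>J (\<lambda>y. H a (mg x y))" using x H[OF a'] by (intro intY)
      have i2: "integrable \<Omega>J (\<lambda>y. F (mg x y))" using x F by (intro intY)
      have i3: "integrable \<Omega>J (\<lambda>y. max 0 (H a (mg x y) - F (mg x y) - c))"
        using x hF[OF a'] bF[OF a'] by (intro intY[of x "\<lambda>z. max 0 (H a z - F z - c)"])
      have "h a x - f x - c = (\<integral>y. H a (mg x y) - F (mg x y) - c \<partial>\<Omega>J)"
        using i1 i2 by (simp add: h_def f_def Y.prob_space)
      also have "\<dots> \<le> (\<integral>y. max 0 (H a (mg x y) - F (mg x y) - c) \<partial>\<Omega>J)"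
        using i1 i2 i3 by (intro integral_mono) auto
      finally show "max 0 (h a x - f x - c) \<le> (\<integral>y. max 0 (H a (mg x y) - F (mg x y) - c) \<partial>\<Omega>J)"
        by (simp add: integral_nonneg_AE)
    qed
    also have "\<dots> = (\<integral>z. max 0 (H a z - F z - c) \<partial>\<Omega> (Suc m))"
      using hF[OF a'] bF[OF a'] by (intro fold[symmetric])
    also have "\<dots> \<le> \<eta>" by (rule excess[OF a'])
    finally show "(\<integral>x. max 0 (h a x - f x - c) \<partial>\<Omega> m) \<le> \<eta>" .
  qed
  then obtain D1 C1 where D1 [measurable]: "D1 \<in> borel_measurable (\<Omega> m)" and C1: "\<And>x. x \<in> space (\<Omega> m) \<Longrightarrow> \<bar>D1 x\<bar> \<le> C1"
    and mgf1: "\<And>l. (\<integral>x. exp (l * D1 x) \<partial>\<Omega> m) \<le> exp (real m * l\<^sup>2 * c\<^sup>2 / 8)"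
    and err1: "(\<integral>x. \<bar>f x - (\<integral>y. f y \<partial>\<Omega> m) - D1 x\<bar> \<partial>\<Omega> m) \<le> 2 * real m * \<eta>"
    by blast
  obtain y0 where y0: "y0 \<in> space \<Omega>J" using Y.not_empty by blast
  define G where "G z = H m z - F z" for z
  define G' where "G' z = min c (G z)" for z
  have [measurable]: "G \<in> borel_measurable (\<Omega> (Suc m))" unfolding G_def using H(1) F by measurable
  hence [measurable]: "G' \<in> borel_measurable (\<Omega> (Suc m))" unfolding G'_def by measurable
  have G0: "0 \<le> G z" "\<bar>G z\<bar> \<le> 2 * K" if "z \<in> space (\<Omega> (Suc m))" for z
    using FH[of m z] H(2)[of m z] F(2)[of z] that by (auto simp: G_def)
  have G'0: "0 \<le> G' z" "G' z \<le> c" "\<bar>G' z\<bar> \<le> c" if "z \<in> space (\<Omega> (Suc m))" for z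
    using G0[OF that] c by (auto simp: G'_def)
  \<comment> \<open>Given the earlier blocks, \<open>H m\<close> is constant, so centring \<open>- G'\<close> over the last block gives the
    truncated increment.\<close>
  define \<mu> where "\<mu> x = (\<integral>y. G' (mg x y) \<partial>\<Omega>J)" for x
  have [measurable]: "\<mu> \<in> borel_measurable (\<Omega> m)" unfolding \<mu>_def by (intro int1) measurable
  define D where "D z = D1 (restrict z (I m)) + (\<mu> (restrict z (I m)) - G' z)" for z
  have rmg: "restrict (mg x y) (I m) = x" if "x \<in> space (\<Omega> m)" for x y
    using that dj by (auto simp: mg_def \<Omega>_def space_PiM fun_eq_iff merge_def PiE_def extensional_def)
  have Dmg: "D (mg x y) = D1 x + (\<mu> x - G' (mg x y))" if "x \<in> space (\<Omega> m)" for x y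
    by (simp add: D_def rmg[OF that])
  have rs: "(\<lambda>z. restrict z (I m)) \<in> measurable (\<Omega> (Suc m)) (\<Omega> m)"
    unfolding \<Omega>_def IJ by (rule measurable_restrict_subset) auto
  have Dm [measurable]: "D \<in> borel_measurable (\<Omega> (Suc m))"
    unfolding D_def using rs by measurable
  have \<mu>b: "\<bar>\<mu> x\<bar> \<le> c" if "x \<in> space (\<Omega> m)" for x
    unfolding \<mu>_def using that G'0 by (intro absY) auto
  have Db: "\<bar>D z\<bar> \<le> C1 + 2 * c" if "z \<in> space (\<Omega> (Suc m))" for z
    using C1[OF measurable_space[OF rs that]] \<mu>b[OF measurable_space[OF rs that]] G'0[OF that]
    by (auto simp: D_def)
  have mgf: "(\<integral>z. exp (l * D z) \<partial>\<Omega> (Suc m)) \<le> exp (real (Suc m) * l\<^sup>2 * c\<^sup>2 / 8)" for l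
  proof -
    have eb: "\<bar>exp (l * D z)\<bar> \<le> exp (\<bar>l\<bar> * (C1 + 2 * c))" if "z \<in> space (\<Omega> (Suc m))" for z
    proof -
      have "l * D z \<le> \<bar>l\<bar> * \<bar>D z\<bar>" by (metis abs_ge_self abs_mult)
      also have "\<dots> \<le> \<bar>l\<bar> * (C1 + 2 * c)" using Db[OF that] by (intro mult_left_mono) auto
      finally show ?thesis by simp
    qed
    have [measurable]: "(\<lambda>z. exp (l * D z)) \<in> borel_measurable (\<Omega> (Suc m))" by measurable
    have "(\<integral>z. exp (l * D z) \<partial>\<Omega> (Suc m)) = (\<integral>x. (\<integral>y. exp (l * D (mg x y)) \<partial>\<Omega>J) \<partial>\<Omega> m)"
      by (rule fold[of "\<lambda>z. exp (l * D z)"]) (use eb in auto)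
    also have "\<dots> \<le> (\<integral>x. exp (l * D1 x) * exp (l\<^sup>2 * c\<^sup>2 / 8) \<partial>\<Omega> m)"
    proof (intro integral_mono)
      show "integrable (\<Omega> m) (\<lambda>x. \<integral>y. exp (l * D (mg x y)) \<partial>\<Omega>J)"
        by (rule intX[of "\<lambda>z. exp (l * D z)"]) (use eb in auto)
      have "l * D1 x \<le> \<bar>l\<bar> * C1" if "x \<in> space (\<Omega> m)" for x
      proof -
        have "l * D1 x \<le> \<bar>l\<bar> * \<bar>D1 x\<bar>" by (metis abs_ge_self abs_mult)
        also have "\<dots> \<le> \<bar>l\<bar> * C1" using C1[OF that] by (intro mult_left_mono) auto
        finally show ?thesis .
      qed
      hence "integrable (\<Omega> m) (\<lambda>x. exp (l * D1 x))"
        by (intro X.integrable_const_bound[where B = "exp (\<bar>l\<bar> * C1)"]) auto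
      thus "integrable (\<Omega> m) (\<lambda>x. exp (l * D1 x) * exp (l\<^sup>2 * c\<^sup>2 / 8))" by simp
      fix x assume x: "x \<in> space (\<Omega> m)"
      have "(\<integral>y. exp (l * D (mg x y)) \<partial>\<Omega>J) = (\<integral>y. exp (l * D1 x) * exp (l * (\<mu> x - G' (mg x y))) \<partial>\<Omega>J)"
        by (simp add: Dmg[OF x] distrib_left exp_add)
      also have "\<dots> = exp (l * D1 x) * (\<integral>y. exp (l * (\<mu> x - G' (mg x y))) \<partial>\<Omega>J)"
        by simp
      also have "\<dots> \<le> exp (l * D1 x) * exp (l\<^sup>2 * c\<^sup>2 / 8)"
        unfolding \<mu>_def using x mgs G'0
        by (intro mult_left_mono Y.mgf_centered_le measurable_compose[OF mgm2]) auto
      finally show "(\<integral>y. exp (l * D (mg x y)) \<partial>\<Omega>J) \<le> exp (l * D1 x) * exp (l\<^sup>2 * c\<^sup>2 / 8)" .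
    qed
    also have "\<dots> = (\<integral>x. exp (l * D1 x) \<partial>\<Omega> m) * exp (l\<^sup>2 * c\<^sup>2 / 8)" by simp
    also have "\<dots> \<le> exp (real m * l\<^sup>2 * c\<^sup>2 / 8) * exp (l\<^sup>2 * c\<^sup>2 / 8)"
      using mgf1[of l] by (intro mult_right_mono) auto
    also have "\<dots> = exp (real (Suc m) * l\<^sup>2 * c\<^sup>2 / 8)"
      by (simp add: field_simps flip: exp_add)
    finally show ?thesis .
  qed
  define e where "e x = (\<integral>y. max 0 (G (mg x y) - c) \<partial>\<Omega>J)" for x
  have exb: "\<bar>max 0 (G z - c)\<bar> \<le> 2 * K + c" if "z \<in> space (\<Omega> (Suc m))" for z
    using bF[of m z] that by (simp add: G_def)
  have exm: "(\<lambda>z. max 0 (G z - c)) \<in> borel_measurable (\<Omega> (Suc m))" by measurable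
  have EF: "(\<integral>z. F z \<partial>\<Omega> (Suc m)) = (\<integral>x. f x \<partial>\<Omega> m)"
    unfolding f_def using F by (rule fold)
  define EFc where "EFc = (\<integral>x. f x \<partial>\<Omega> m)"
  have Ee: "(\<integral>x. e x \<partial>\<Omega> m) \<le> \<eta>"
  proof -
    have "(\<integral>x. e x \<partial>\<Omega> m) = (\<integral>z. max 0 (G z - c) \<partial>\<Omega> (Suc m))"
      unfolding e_def by (rule fold[OF exm exb, symmetric])
    also have "\<dots> \<le> \<eta>" unfolding G_def by (rule excess) simp
    finally show ?thesis .
  qed
  have inte: "integrable (\<Omega> m) e"
    unfolding e_def by (rule intX[OF exm exb])
  have intr: "integrable (\<Omega> m) (\<lambda>x. \<bar>f x - EFc - D1 x\<bar>)"
  proof (intro integrable_abs Bochner_Integration.integrable_diff)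
    have "\<bar>f x\<bar> \<le> K" if "x \<in> space (\<Omega> m)" for x
      unfolding f_def using that F by (intro absY)
    thus "integrable (\<Omega> m) f" by (intro X.integrable_const_bound[where B = K]) auto
    show "integrable (\<Omega> m) D1" using C1 by (intro X.integrable_const_bound[where B = C1]) auto
  qed auto
  have pt: "\<bar>F (mg x y) - EFc - D (mg x y)\<bar> \<le> \<bar>f x - EFc - D1 x\<bar> + (max 0 (G (mg x y) - c) + e x)"
    if x: "x \<in> space (\<Omega> m)" and y: "y \<in> space \<Omega>J" for x y
  proof -
    have i1: "integrable \<Omega>J (\<lambda>y. G (mg x y))" using x G0(2) by (intro intY) auto
    have i2: "integrable \<Omega>J (\<lambda>y. G' (mg x y))" using x G'0(3) by (intro intY) auto
    have Hc: "H m (mg x y') = H m (mg x y)" if "y' \<in> space \<Omega>J" for y'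
      using x y that by (intro Hind mgs) (auto simp: mg_def merge_def IJ J_def)
    have "f x = (\<integral>y'. H m (mg x y) - G (mg x y') \<partial>\<Omega>J)"
      unfolding f_def by (intro Bochner_Integration.integral_cong) (auto simp: G_def Hc)
    also have "\<dots> = H m (mg x y) - (\<integral>y'. G (mg x y') \<partial>\<Omega>J)"
      using i1 by (simp add: Y.prob_space)
    finally have fx: "f x = H m (mg x y) - (\<integral>y'. G (mg x y') \<partial>\<Omega>J)" .
    have split: "max 0 (G z - c) = G z - G' z" for z by (auto simp: G'_def)
    have ex: "e x = (\<integral>y'. G (mg x y') \<partial>\<Omega>J) - \<mu> x"
      using i1 i2 by (simp add: e_def split \<mu>_def)
    have "e x \<ge> 0" by (simp add: e_def integral_nonneg_AE)
    have "F (mg x y) - EFc - D (mg x y) = (f x - EFc - D1 x) + (e x - max 0 (G (mg x y) - c))"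
      unfolding Dmg[OF x] split ex fx by (simp add: G_def)
    thus ?thesis using \<open>e x \<ge> 0\<close> by linarith
  qed
  have "(\<integral>z. \<bar>F z - EFc - D z\<bar> \<partial>\<Omega> (Suc m)) \<le> 2 * real (Suc m) * \<eta>"
  proof -
    have rb: "\<bar>\<bar>F z - EFc - D z\<bar>\<bar> \<le> K + \<bar>EFc\<bar> + (C1 + 2 * c)" if "z \<in> space (\<Omega> (Suc m))" for z
      using F(2)[OF that] Db[OF that] by linarith
    have rm: "(\<lambda>z. \<bar>F z - EFc - D z\<bar>) \<in> borel_measurable (\<Omega> (Suc m))" using F(1) by measurable
    have "(\<integral>z. \<bar>F z - EFc - D z\<bar> \<partial>\<Omega> (Suc m)) = (\<integral>x. (\<integral>y. \<bar>F (mg x y) - EFc - D (mg x y)\<bar> \<partial>\<Omega>J) \<partial>\<Omega> m)"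
      by (rule fold[OF rm rb])
    also have "\<dots> \<le> (\<integral>x. \<bar>f x - EFc - D1 x\<bar> + 2 * e x \<partial>\<Omega> m)"
    proof (rule integral_mono)
      show "integrable (\<Omega> m) (\<lambda>x. \<integral>y. \<bar>F (mg x y) - EFc - D (mg x y)\<bar> \<partial>\<Omega>J)"
        by (rule intX[OF rm rb])
      show "integrable (\<Omega> m) (\<lambda>x. \<bar>f x - EFc - D1 x\<bar> + 2 * e x)" using intr inte by simp
      fix x assume x: "x \<in> space (\<Omega> m)"
      have i3: "integrable \<Omega>J (\<lambda>y. max 0 (G (mg x y) - c))"
        by (rule intY[OF x exm exb])
      have "(\<integral>y. \<bar>F (mg x y) - EFc - D (mg x y)\<bar> \<partial>\<Omega>J)
          \<le> (\<integral>y. \<bar>f x - EFc - D1 x\<bar> + (max 0 (G (mg x y) - c) + e x) \<partial>\<Omega>J)"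
        using pt[OF x] i3 by (intro integral_mono intY[OF x rm rb]) auto
      also have "\<dots> = \<bar>f x - EFc - D1 x\<bar> + 2 * e x"
        using i3 by (simp add: Y.prob_space e_def)
      finally show "(\<integral>y. \<bar>F (mg x y) - EFc - D (mg x y)\<bar> \<partial>\<Omega>J) \<le> \<bar>f x - EFc - D1 x\<bar> + 2 * e x" .
    qed
    also have "\<dots> = (\<integral>x. \<bar>f x - EFc - D1 x\<bar> \<partial>\<Omega> m) + 2 * (\<integral>x. e x \<partial>\<Omega> m)"
      using intr inte by simp
    also have "\<dots> \<le> 2 * real m * \<eta> + 2 * \<eta>"
      using err1 Ee unfolding EFc_def by (intro add_mono) auto
    finally show ?thesis by (simp add: algebra_simps)
  qed
  hence err: "(\<integral>z. \<bar>F z - (\<integral>y. F y \<partial>\<Omega> (Suc m)) - D z\<bar> \<partial>\<Omega> (Suc m)) \<le> 2 * real (Suc m) * \<eta>"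
    unfolding EFc_def EF .
  show ?case
    using Dm Db mgf err by blast
qed

text \<open>
  Chernoff's bound for the approximating martingale and Markov's inequality for the error, at levels
  \<open>t\<close> and \<open>s\<close>.
\<close>
lemma block_concentration:
  fixes Mi :: "'i \<Rightarrow> 'a measure" and B :: "nat \<Rightarrow> 'i set" and F :: "('i \<Rightarrow> 'a) \<Rightarrow> real" and H :: "nat \<Rightarrow> ('i \<Rightarrow> 'a) \<Rightarrow> real"
  assumes P: "\<And>i. prob_space (Mi i)" and finB: "\<And>a. finite (B a)" and disj: "\<And>a a'. a \<noteq> a' \<Longrightarrow> B a \<inter> B a' = {}"
    and c: "c > 0" and \<Omega>: "\<Omega> = PiM (\<Union>a<m. B a) Mi"
    and F: "F \<in> borel_measurable \<Omega>" "\<And>x. x \<in> space \<Omega> \<Longrightarrow> \<bar>F x\<bar> \<le> K"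
    and H: "\<And>a. a < m \<Longrightarrow> H a \<in> borel_measurable \<Omega>" "\<And>a x. a < m \<Longrightarrow> x \<in> space \<Omega> \<Longrightarrow> \<bar>H a x\<bar> \<le> K"
    and FH: "\<And>a x. a < m \<Longrightarrow> x \<in> space \<Omega> \<Longrightarrow> F x \<le> H a x"
    and Hind: "\<And>a x y. a < m \<Longrightarrow> x \<in> space \<Omega> \<Longrightarrow> y \<in> space \<Omega> \<Longrightarrow> (\<forall>i\<in>(\<Union>a<m. B a) - B a. x i = y i) \<Longrightarrow> H a x = H a y"
    and excess: "\<And>a. a < m \<Longrightarrow> (\<integral>x. max 0 (H a x - F x - c) \<partial>\<Omega>) \<le> \<eta>"
    and V: "real m \<le> V" "V > 0" and t: "t > 0" and s: "s > 0"
  shows "measure \<Omega> {x \<in> space \<Omega>. t + s \<le> \<bar>F x - (\<integral>y. F y \<partial>\<Omega>)\<bar>} \<le> 2 * exp (- 2 * t\<^sup>2 / (V * c\<^sup>2)) + 2 * real m * \<eta> / s"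
proof -
  interpret prob_space \<Omega> unfolding \<Omega> using P by (rule prob_space_PiM)
  obtain D C where D [measurable]: "D \<in> borel_measurable \<Omega>" and C: "\<And>x. x \<in> space \<Omega> \<Longrightarrow> \<bar>D x\<bar> \<le> C"
    and mgf: "\<And>l. (\<integral>x. exp (l * D x) \<partial>\<Omega>) \<le> exp (real m * l\<^sup>2 * c\<^sup>2 / 8)"
    and err: "(\<integral>x. \<bar>F x - (\<integral>y. F y \<partial>\<Omega>) - D x\<bar> \<partial>\<Omega>) \<le> 2 * real m * \<eta>"
  proof -
    have "\<exists>D C. D \<in> borel_measurable \<Omega> \<and> (\<forall>x\<in>space \<Omega>. \<bar>D x\<bar> \<le> C)
      \<and> (\<forall>l. (\<integral>x. exp (l * D x) \<partial>\<Omega>) \<le> exp (real m * l\<^sup>2 * c\<^sup>2 / 8))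
      \<and> (\<integral>x. \<bar>F x - (\<integral>y. F y \<partial>\<Omega>) - D x\<bar> \<partial>\<Omega>) \<le> 2 * real m * \<eta>"
      unfolding \<Omega>
      by (rule block_martingale_approximation[OF P finB disj less_imp_le[OF c] F[unfolded \<Omega>] H[unfolded \<Omega>]
            FH[unfolded \<Omega>] Hind[unfolded \<Omega>] excess[unfolded \<Omega>]])
    thus thesis using that by blast
  qed
  note [measurable] = F(1)
  define e where "e x = \<bar>F x - (\<integral>y. F y \<partial>\<Omega>) - D x\<bar>" for x
  have [measurable]: "e \<in> borel_measurable \<Omega>" unfolding e_def by measurable
  have tail: "measure \<Omega> {x \<in> space \<Omega>. t \<le> \<sigma> * D x} \<le> exp (- 2 * t\<^sup>2 / (V * c\<^sup>2))" if \<sigma>: "\<sigma>\<^sup>2 = 1" for \<sigma> :: real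
  proof -
    \<comment> \<open>the minimiser of \<open>V * l\<^sup>2 * c\<^sup>2 / 8 - l * t\<close>\<close>
    define l where "l = 4 * t / (V * c\<^sup>2)"
    have l: "l > 0" using t V c by (simp add: l_def)
    have int: "integrable \<Omega> (\<lambda>x. exp (l * (\<sigma> * D x)))"
    proof (rule integrable_const_bound[where B = "exp (l * C)"])
      have "\<sigma> * D x \<le> C" if "x \<in> space \<Omega>" for x
      proof -
        have "\<sigma> = 1 \<or> \<sigma> = - 1" using \<sigma> by (simp add: power2_eq_1_iff)
        thus ?thesis using C[OF that] by auto
      qed
      thus "AE x in \<Omega>. norm (exp (l * (\<sigma> * D x))) \<le> exp (l * C)"
        using l by (intro AE_I2) (auto intro!: mult_left_mono)
    qed measurable
    have "{x \<in> space \<Omega>. t \<le> \<sigma> * D x} = {x \<in> space \<Omega>. exp (l * t) \<le> exp (l * (\<sigma> * D x))}"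
      using l by simp
    also have "measure \<Omega> \<dots> \<le> (\<integral>x. exp (l * (\<sigma> * D x)) \<partial>\<Omega>) / exp (l * t)"
      using int by (intro integral_Markov_inequality_measure[where A = "{}"]) auto
    also have "(\<integral>x. exp (l * (\<sigma> * D x)) \<partial>\<Omega>) \<le> exp (real m * l\<^sup>2 * c\<^sup>2 / 8)"
      using mgf[of "l * \<sigma>"] \<sigma> by (simp add: power_mult_distrib mult.assoc)
    also have "\<dots> \<le> exp (V * l\<^sup>2 * c\<^sup>2 / 8)"
      using V by (simp add: mult_right_mono)
    also have "exp (V * l\<^sup>2 * c\<^sup>2 / 8) / exp (l * t) = exp (- 2 * t\<^sup>2 / (V * c\<^sup>2))"
    proof -
      have "V * l\<^sup>2 * c\<^sup>2 / 8 - l * t = - 2 * t\<^sup>2 / (V * c\<^sup>2)"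
        using V c by (simp add: l_def power2_eq_square field_simps)
      thus ?thesis by (simp flip: exp_diff)
    qed
    finally show ?thesis by (simp add: divide_right_mono)
  qed
  have "measure \<Omega> {x \<in> space \<Omega>. t + s \<le> \<bar>F x - (\<integral>y. F y \<partial>\<Omega>)\<bar>}
     \<le> measure \<Omega> (({x \<in> space \<Omega>. t \<le> 1 * D x} \<union> {x \<in> space \<Omega>. t \<le> (- 1) * D x}) \<union> {x \<in> space \<Omega>. s \<le> e x})"
    by (intro finite_measure_mono) (auto simp: e_def)
  also have "\<dots> \<le> measure \<Omega> ({x \<in> space \<Omega>. t \<le> 1 * D x} \<union> {x \<in> space \<Omega>. t \<le> (- 1) * D x}) + measure \<Omega> {x \<in> space \<Omega>. s \<le> e x}"
    by (intro measure_Un_le) measurable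
  also have "measure \<Omega> ({x \<in> space \<Omega>. t \<le> 1 * D x} \<union> {x \<in> space \<Omega>. t \<le> (- 1) * D x})
      \<le> measure \<Omega> {x \<in> space \<Omega>. t \<le> 1 * D x} + measure \<Omega> {x \<in> space \<Omega>. t \<le> (- 1) * D x}"
    by (intro measure_Un_le) measurable
  also have "measure \<Omega> {x \<in> space \<Omega>. t \<le> 1 * D x} \<le> exp (- 2 * t\<^sup>2 / (V * c\<^sup>2))"
    by (rule tail) simp
  also have "measure \<Omega> {x \<in> space \<Omega>. t \<le> (- 1) * D x} \<le> exp (- 2 * t\<^sup>2 / (V * c\<^sup>2))"
    by (rule tail) simp
  also have "measure \<Omega> {x \<in> space \<Omega>. s \<le> e x} \<le> (\<integral>x. e x \<partial>\<Omega>) / s"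
  proof (rule integral_Markov_inequality_measure[where A = "{}"])
    show "integrable \<Omega> e"
    proof (rule integrable_const_bound[where B = "K + \<bar>\<integral>y. F y \<partial>\<Omega>\<bar> + C"])
      show "AE x in \<Omega>. norm (e x) \<le> K + \<bar>\<integral>y. F y \<partial>\<Omega>\<bar> + C"
      proof (rule AE_I2)
        fix x assume "x \<in> space \<Omega>"
        from F(2)[OF this] C[OF this] show "norm (e x) \<le> K + \<bar>\<integral>y. F y \<partial>\<Omega>\<bar> + C"
          by (simp add: e_def)
      qed
    qed measurable
  qed (use s in \<open>auto simp: e_def\<close>)
  also have "\<dots> \<le> 2 * real m * \<eta> / s"
    using err s by (intro divide_right_mono) (auto simp: e_def[abs_def])
  finally show ?thesis by simp
qed

section \<open>Removing one row\<close>

lemma trunc_log_bounds: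
  assumes "A \<ge> 0" "x \<le> 1"
  shows "- A \<le> trunc_log A x" "trunc_log A x \<le> 0"
  using assms by (auto simp: trunc_log_def)

lemma trunc_log_mono:
  assumes "x \<le> y"
  shows "trunc_log A x \<le> trunc_log A y"
  using assms by (auto simp: trunc_log_def intro: ln_mono max.coboundedI2)

text \<open>
  Lowering \<open>y\<close> to \<open>x\<close> lowers the truncated logarithm by more than \<open>ln n\<close> only if \<open>y\<close> is above the
  truncation level and the ratio is below \<open>1 / n\<close>; even then the drop is at most \<open>A\<close>.
\<close>
lemma trunc_log_gap:
  assumes A: "A \<ge> 0" and xy: "0 \<le> x" "x \<le> y" "y \<le> 1" and n: "n \<ge> 1"
  shows "max 0 (trunc_log A y - trunc_log A x - ln n) \<le> A * of_bool (exp (- A) < y \<and> x / y < 1 / n)"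
proof -
  have ln: "ln n \<ge> 0" using n by simp
  have bx: "- A \<le> trunc_log A x" using A xy by (intro trunc_log_bounds) auto
  have byy: "trunc_log A y \<le> 0" using A xy by (intro trunc_log_bounds) auto
  consider "exp (- A) < y \<and> x / y < 1 / n" | "y \<le> exp (- A)" | "exp (- A) < y" "1 / n \<le> x / y" by linarith
  thus ?thesis
  proof cases
    case 1
    thus ?thesis using bx byy ln A by simp
  next
    case 2
    have "trunc_log A y = - A"
    proof (cases "y > 0")
      case True
      hence "ln y \<le> ln (exp (- A))" using 2 by (intro ln_mono)
      thus ?thesis using True by (simp add: trunc_log_def)
    qed (simp add: trunc_log_def)
    thus ?thesis using bx ln A by simp
  next
    case 3
    have y: "y > 0" using 3(1) by (meson exp_gt_zero less_trans)
    hence xn: "y / n \<le> x" using 3(2) n by (simp add: field_simps)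
    hence x: "x > 0" using y n by (meson divide_pos_pos less_le_trans zero_less_one)
    have "ln (exp (- A)) < ln y" using 3(1) y by (subst ln_less_cancel_iff) auto
    hence "trunc_log A y = ln y" using y by (simp add: trunc_log_def)
    moreover have "ln y - ln n \<le> ln x"
    proof -
      have "ln (y / n) \<le> ln x" using xn y n by (intro ln_mono) auto
      thus ?thesis using y n by (simp add: ln_div)
    qed
    moreover have "ln x \<le> trunc_log A x" using x by (simp add: trunc_log_def)
    ultimately show ?thesis using A by simp
  qed
qed

lemma measurable_trunc_log [measurable]: "trunc_log A \<in> borel_measurable borel"
  unfolding trunc_log_def[abs_def] by measurable

text \<open>
  The partition function with row \<open>a\<close> removed from the matrix.
\<close>
definition cavity_Z :: "(real \<Rightarrow> real) \<Rightarrow> nat \<Rightarrow> nat \<Rightarrow> nat \<Rightarrow> (nat \<Rightarrow> nat \<Rightarrow> real) \<Rightarrow> real" where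
  "cavity_Z U M N a G =
     (\<Sum>J\<in>cube {..<N}. \<Prod>b\<in>{..<M} - {a}. U ((\<Sum>i<N. G b i * J i) / sqrt (real N)))"

lemma gaussian_matrix_eq: "gaussian_matrix M N = gauss ({..<M} \<times> {..<N})"
  by (simp add: gaussian_matrix_def gauss_def)

lemma cavity_Z_bounds:
  assumes U01: "\<And>x. 0 \<le> U x" "\<And>x. U x \<le> 1" and a: "a < M"
  shows "0 \<le> partition_Z U M N G" "partition_Z U M N G \<le> cavity_Z U M N a G" "cavity_Z U M N a G \<le> 2 ^ N"
proof -
  show "0 \<le> partition_Z U M N G"
    unfolding partition_Z_def using U01 by (intro sum_nonneg prod_nonneg) auto
  show "partition_Z U M N G \<le> cavity_Z U M N a G"
    unfolding partition_Z_def cavity_Z_def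
  proof (rule sum_mono)
    fix J
    let ?u = "\<lambda>b. U ((\<Sum>i<N. G b i * J i) / sqrt (real N))"
    have "(\<Prod>b<M. ?u b) = ?u a * (\<Prod>b\<in>{..<M} - {a}. ?u b)"
      using a by (subst prod.remove[of _ a]) auto
    also have "\<dots> \<le> 1 * (\<Prod>b\<in>{..<M} - {a}. ?u b)"
      using U01 by (intro mult_right_mono prod_nonneg) auto
    finally show "(\<Prod>b<M. ?u b) \<le> (\<Prod>b\<in>{..<M} - {a}. ?u b)" by simp
  qed
  have "cavity_Z U M N a G \<le> (\<Sum>J\<in>cube {..<N}. 1)"
    unfolding cavity_Z_def using U01 by (intro sum_mono prod_le_1) auto
  thus "cavity_Z U M N a G \<le> 2 ^ N"
    by (simp add: card_PiE numeral_2_eq_2)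
qed

text \<open>
  Up to the normalisation by the cavity partition function, \<open>partition_Z\<close> is the Gibbs average of the
  factor of row \<open>a\<close> under the weights given by the other rows.
\<close>
lemma partition_Z_eq_gibbs:
  assumes "a < M"
  shows "partition_Z U M N G = (\<Sum>J\<in>cube {..<N}. (\<Prod>b\<in>{..<M} - {a}. U ((\<Sum>i<N. G b i * J i) / sqrt (real N)))
            * U ((\<Sum>i<N. G a i * J i) / sqrt (real N)))"
  unfolding partition_Z_def using assms by (intro sum.cong refl, subst prod.remove[of _ a]) (auto simp: mult.commute)

lemma measurable_row_field [measurable]:
  assumes [measurable]: "U \<in> borel_measurable borel" and "b < M"
  shows "(\<lambda>\<omega>. U ((\<Sum>i<N. \<omega> (b, i) * J i) / sqrt (real N))) \<in> borel_measurable (gauss ({..<M} \<times> {..<N}))"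
proof -
  have [measurable]: "(\<lambda>\<omega>. \<omega> (b, i)) \<in> borel_measurable (gauss ({..<M} \<times> {..<N}))" if "i \<in> {..<N}" for i
  proof -
    have "(\<lambda>\<omega>. \<omega> (b, i)) \<in> measurable (gauss ({..<M} \<times> {..<N})) std_gaussian"
      unfolding gauss_def using that assms(2) by (intro measurable_component_singleton) auto
    thus ?thesis using measurable_cong_sets[OF refl sets_std_gaussian] by blast
  qed
  show ?thesis by measurable
qed

lemma measurable_partition_Z:
  assumes [measurable]: "U \<in> borel_measurable borel"
  shows "(\<lambda>\<omega>. partition_Z U M N (curry \<omega>)) \<in> borel_measurable (gauss ({..<M} \<times> {..<N}))"
    and "(\<lambda>\<omega>. cavity_Z U M N a (curry \<omega>)) \<in> borel_measurable (gauss ({..<M} \<times> {..<N}))"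
  unfolding partition_Z_def cavity_Z_def curry_def
  by (intro borel_measurable_sum borel_measurable_prod measurable_row_field assms; simp)+

lemma distr_gauss_row:
  "distr (gauss ({a} \<times> {..<N})) (gauss {..<N}) (\<lambda>\<omega>. \<lambda>i\<in>{..<N}. \<omega> (a, i)) = gauss {..<N}"
  unfolding gauss_def
  using distr_PiM_reindex[of "{a} \<times> {..<N}" "\<lambda>_. std_gaussian" "\<lambda>i. (a, i)" "{..<N}"] prob_space_std_gaussian
  by (auto simp: inj_on_def)

text \<open>
  Row \<open>a\<close> is integrated first, for fixed values of the others. Above the truncation level the cavity
  partition function is at least \<open>2 ^ N * exp (- A)\<close>, so the Gibbs weights \<open>w\<close> of the other rows are at
  most \<open>exp A / 2 ^ N\<close>, and \<open>gibbs_average_small_probability\<close> applies with \<open>W = exp A\<close>.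
\<close>
lemma row_excess_le:
  fixes U :: "real \<Rightarrow> real"
  assumes N: "N > 0" and a: "a < M" and A: "A \<ge> 0"
    and \<epsilon>: "0 < \<epsilon>" "\<epsilon> \<le> 1 / 2" and R: "R \<ge> 0"
    and U [measurable]: "U \<in> borel_measurable borel" and U01: "\<And>x. 0 \<le> U x" "\<And>x. U x \<le> 1"
    and E: "E \<in> sets borel" "E \<subseteq> {-K..K}" and hit: "\<And>x. x \<in> E \<Longrightarrow> \<delta> \<le> U x" and \<delta>: "\<delta> > 0"
    and vol: "vol \<le> measure lborel E" "vol \<ge> 0" and n: "n \<ge> 2"
  shows "(\<integral>\<omega>. max 0 (trunc_log A (cavity_Z U M N a (curry \<omega>) / 2 ^ N)
            - trunc_log A (partition_Z U M N (curry \<omega>) / 2 ^ N) - ln (real n)) \<partial>gauss ({..<M} \<times> {..<N}))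
    \<le> A * (9 * (exp (- (real n * (\<delta> / sqrt (2 * pi) * exp (- (K + R)\<^sup>2) * vol)))
       + real n * (2 * exp (- R\<^sup>2 / (2 * \<epsilon>)) + exp A * exp (- \<epsilon> * real N / 4) * sqrt 2 ^ n)))"
    (is "_ \<le> A * ?T")
proof -
  let ?I = "{..<M} \<times> {..<N}" and ?I' = "({..<M} - {a}) \<times> {..<N}" and ?J = "{a} \<times> {..<N}"
  let ?Q = "{\<omega> \<in> space (gauss ?I). exp (- A) < cavity_Z U M N a (curry \<omega>) / 2 ^ N \<and>
      partition_Z U M N (curry \<omega>) / cavity_Z U M N a (curry \<omega>) < 1 / real n}"
  note [measurable] = measurable_partition_Z[OF U]
  \<comment> \<open>The gap exceeds \<open>ln n\<close> only on \<open>?Q\<close>, and \<open>?T\<close> bounds the probability of \<open>?Q\<close>.\<close>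
  have T0: "?T \<ge> 0" by simp
  have Qm [measurable]: "?Q \<in> sets (gauss ?I)" by measurable
  have un: "?I' \<union> ?J = ?I" "?I' \<inter> ?J = {}" using a by auto
  have inner: "(\<integral>\<^sup>+y. indicator ?Q (merge ?I' ?J (x, y)) \<partial>gauss ?J) \<le> ennreal ?T" if x: "x \<in> space (gauss ?I')" for x
  proof -
    define w0 where "w0 J = (\<Prod>b\<in>{..<M} - {a}. U ((\<Sum>i<N. x (b, i) * J i) / sqrt (real N)))" for J
    define Z0 where "Z0 = (\<Sum>J\<in>cube {..<N}. w0 J)"
    have w0: "0 \<le> w0 J" "w0 J \<le> 1" for J
      unfolding w0_def using U01 by (auto intro!: prod_nonneg prod_le_1)
    have cav: "cavity_Z U M N a (curry (merge ?I' ?J (x, y))) = Z0" for y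
      unfolding cavity_Z_def Z0_def w0_def by (intro sum.cong prod.cong refl arg_cong[of _ _ U]) (auto simp: merge_def)
    have part: "partition_Z U M N (curry (merge ?I' ?J (x, y))) =
        (\<Sum>J\<in>cube {..<N}. w0 J * U (dot {..<N} (\<lambda>i\<in>{..<N}. y (a, i)) J / sqrt (real N)))" for y
      unfolding partition_Z_eq_gibbs[OF a] w0_def
      by (intro sum.cong prod.cong arg_cong2[of _ _ _ _ "(*)"] refl arg_cong[of _ _ U]) (auto simp: merge_def dot_def)
    show ?thesis
    proof (cases "exp (- A) < Z0 / 2 ^ N")
      case False
      thus ?thesis using cav by (simp add: indicator_def)
    next
      case True
      have Z0: "Z0 > 0" using True by (smt (verit) exp_gt_zero zero_less_divide_iff zero_less_power)
      define w where "w J = w0 J / Z0" for J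
      define S where "S = {u \<in> space (gauss {..<N}). (\<Sum>J\<in>cube {..<N}. w J * U (dot {..<N} u J / sqrt (real (card {..<N})))) < 1 / real n}"
      have [measurable]: "S \<in> sets (gauss {..<N})" unfolding S_def by measurable
      have "1 / Z0 \<le> exp A / 2 ^ N"
        using True Z0 by (simp add: field_simps exp_minus)
      hence wW: "w J \<le> exp A / 2 ^ card {..<N}" for J
        using w0[of J] Z0 by (simp add: w_def) (meson divide_right_mono less_imp_le order_trans)
      have "measure (gauss {..<N}) S \<le> 9 * (exp (- (real n * (\<delta> / sqrt (2 * pi) * exp (- (K + R)\<^sup>2) * vol)))
         + real n * (2 * exp (- R\<^sup>2 / (2 * \<epsilon>)) + exp A * exp (- \<epsilon> * real (card {..<N}) / 4) * sqrt 2 ^ n))"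
        unfolding S_def
      proof (rule gibbs_average_small_probability[OF _ _ \<epsilon> R U U01 E hit \<delta> vol(1) _ _ wW _ n vol(2)])
        show "(\<Sum>J\<in>cube {..<N}. w J) = 1"
          using Z0 by (simp add: w_def Z0_def flip: sum_divide_distrib)
      qed (use N w0 Z0 in \<open>auto simp: w_def\<close>)
      hence S: "emeasure (gauss {..<N}) S \<le> ennreal ?T"
        unfolding gauss.emeasure_eq_measure by (intro ennreal_leI) simp
      have rowm: "(\<lambda>y. \<lambda>i\<in>{..<N}. y (a, i)) \<in> measurable (gauss ?J) (gauss {..<N})"
        unfolding gauss_def by (intro measurable_restrict measurable_component_singleton) auto
      have "(\<integral>\<^sup>+y. indicator ?Q (merge ?I' ?J (x, y)) \<partial>gauss ?J) \<le> (\<integral>\<^sup>+y. indicator S (\<lambda>i\<in>{..<N}. y (a, i)) \<partial>gauss ?J)"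
      proof (intro nn_integral_mono)
        fix y assume y: "y \<in> space (gauss ?J)"
        have "merge ?I' ?J (x, y) \<in> ?Q \<Longrightarrow> (\<lambda>i\<in>{..<N}. y (a, i)) \<in> S"
          unfolding S_def using Z0 measurable_space[OF rowm y]
          by (simp add: cav part w_def sum_divide_distrib)
        thus "indicator ?Q (merge ?I' ?J (x, y)) \<le> (indicator S (\<lambda>i\<in>{..<N}. y (a, i)) :: ennreal)"
          by (auto simp: indicator_def)
      qed
      also have "\<dots> = (\<integral>\<^sup>+u. indicator S u \<partial>distr (gauss ?J) (gauss {..<N}) (\<lambda>y. \<lambda>i\<in>{..<N}. y (a, i)))"
        by (rule nn_integral_distr[OF rowm, symmetric]) measurable
      also have "\<dots> = emeasure (gauss {..<N}) S"
        unfolding distr_gauss_row by simp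
      finally show ?thesis using S by simp
    qed
  qed
  have "emeasure (gauss ?I) ?Q = (\<integral>\<^sup>+\<omega>. indicator ?Q \<omega> \<partial>gauss ?I)" by simp
  also have "\<dots> = (\<integral>\<^sup>+x. (\<integral>\<^sup>+y. indicator ?Q (merge ?I' ?J (x, y)) \<partial>gauss ?J) \<partial>gauss ?I')"
  proof -
    have "(indicator ?Q :: _ \<Rightarrow> ennreal) \<in> borel_measurable (gauss ?I)" by measurable
    thus ?thesis
      using gauss_prod.product_nn_integral_fold[of ?I' ?J "indicator ?Q"] un
      unfolding gauss_def by simp
  qed
  also have "\<dots> \<le> (\<integral>\<^sup>+x. ennreal ?T \<partial>gauss ?I')"
    using inner by (intro nn_integral_mono)
  also have "\<dots> = ennreal ?T" by (simp add: gauss.emeasure_space_1)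
  finally have "ennreal (measure (gauss ?I) ?Q) \<le> ennreal ?T"
    unfolding gauss.emeasure_eq_measure .
  hence Q: "measure (gauss ?I) ?Q \<le> ?T"
    unfolding ennreal_le_iff[OF T0] .
  have Zs: "0 \<le> partition_Z U M N (curry \<omega>) / 2 ^ N" "partition_Z U M N (curry \<omega>) / 2 ^ N \<le> cavity_Z U M N a (curry \<omega>) / 2 ^ N"
    "cavity_Z U M N a (curry \<omega>) / 2 ^ N \<le> 1" for \<omega>
    using cavity_Z_bounds[OF U01 a, where N = N and G = "curry \<omega>"] by (auto simp: divide_right_mono)
  have gap: "max 0 (trunc_log A (cavity_Z U M N a (curry \<omega>) / 2 ^ N)
            - trunc_log A (partition_Z U M N (curry \<omega>) / 2 ^ N) - ln (real n)) \<le> A * indicator ?Q \<omega>"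
    if "\<omega> \<in> space (gauss ?I)" for \<omega>
    using trunc_log_gap[OF A Zs[of \<omega>], of "real n"] n that by (simp add: indicator_def of_bool_def)
  have "(\<integral>\<omega>. max 0 (trunc_log A (cavity_Z U M N a (curry \<omega>) / 2 ^ N)
            - trunc_log A (partition_Z U M N (curry \<omega>) / 2 ^ N) - ln (real n)) \<partial>gauss ?I)
     \<le> (\<integral>\<omega>. A * indicator ?Q \<omega> \<partial>gauss ?I)"
  proof (rule integral_mono)
    show i: "integrable (gauss ?I) (\<lambda>\<omega>. A * indicator ?Q \<omega>)"
      by (intro gauss.integrable_const_bound[where B = A]) (use A in \<open>auto simp: indicator_def\<close>)
    show "integrable (gauss ?I) (\<lambda>\<omega>. max 0 (trunc_log A (cavity_Z U M N a (curry \<omega>) / 2 ^ N)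
            - trunc_log A (partition_Z U M N (curry \<omega>) / 2 ^ N) - ln (real n)))"
    proof (rule gauss.integrable_const_bound[where B = A, OF AE_I2])
      fix \<omega> assume \<omega>: "\<omega> \<in> space (gauss ?I)"
      show "norm (max 0 (trunc_log A (cavity_Z U M N a (curry \<omega>) / 2 ^ N)
            - trunc_log A (partition_Z U M N (curry \<omega>) / 2 ^ N) - ln (real n))) \<le> A"
        unfolding real_norm_def abs_of_nonneg[OF max.cobounded1]
        by (rule order_trans[OF gap[OF \<omega>]]) (use A in \<open>simp add: indicator_def\<close>)
    qed measurable
  qed (rule gap)
  also have "\<dots> = A * measure (gauss ?I) ?Q" by simp
  also have "\<dots> \<le> A * ?T" using Q A by (intro mult_left_mono)
  finally show ?thesis .
qed

section \<open>Choice of the parameters\<close>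

text \<open>
  The exponents come from the choices \<open>n \<approx> sqrt N\<close>, \<open>\<epsilon> = 1 / 128\<close>, \<open>R\<^sup>2 = ln N / 8\<close> and \<open>W = exp (N * exp (- 12))\<close>
  in the replica bound: a hit has probability of order \<open>exp (- 2 * R\<^sup>2) = N powr (- 1 / 4)\<close>, so
  that \<open>n\<close> attempts are plenty; a mean above \<open>R\<close> has probability \<open>2 * N powr (- 8)\<close>;
  and \<open>exp (- 12) - \<epsilon> / 4 \<le> 1 / 4096 - 1 / 512 = - 7 / 4096\<close>.
\<close>
lemma eventually_excess_negligible:
  fixes \<kappa> :: real
  assumes "\<kappa> > 0"
  shows "eventually (\<lambda>x::real. 9 * (exp (- ((sqrt x - 1) * (\<kappa> * x powr (- 1 / 4))))
     + sqrt x * (2 * x powr (- 8) + exp (- (7 / 4096) * x) * exp (sqrt x))) \<le> x powr (- 4) / 4) at_top"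
  using assms by real_asymp

text \<open>
  The increments are cut at \<open>c = ln n\<close>, at most \<open>ln N / 2\<close>, and the deviation \<open>sqrt N * (ln N)\<^sup>2\<close> is shared equally
  between the martingale and the error. The martingale part is then at most
  \<open>2 * exp (- 2 * (ln N)\<^sup>2)\<close>, and the error part at most \<open>2 * N\<close> times the excess \<open>A * T\<close> of a single row; each of them
  is at most half of \<open>1 / N\<^sup>2\<close>.
\<close>
lemma gaussian_partition_concentration:
  fixes U :: "real \<Rightarrow> real"
  assumes U [measurable]: "U \<in> borel_measurable borel" and U01: "\<And>x. 0 \<le> U x" "\<And>x. U x \<le> 1"
    and E: "E \<in> sets borel" "E \<subseteq> {-K..K}" and hit: "\<And>x. x \<in> E \<Longrightarrow> \<delta> \<le> U x" and \<delta>: "\<delta> > 0"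
    and vol: "vol \<le> measure lborel E" "vol \<ge> 0"
    and MN: "M \<le> N" and lnN: "ln (real N) \<ge> 2" and sqN: "sqrt (real N) \<ge> 3"
    and large: "sqrt (real N) * (ln (real N))\<^sup>2 / 2 \<ge> 1"
    and small: "9 * (exp (- ((sqrt (real N) - 1) * (\<delta> / sqrt (2 * pi) * exp (- 2 * K\<^sup>2) * vol * real N powr (- 1 / 4))))
     + sqrt (real N) * (2 * real N powr (- 8) + exp (- (7 / 4096) * real N) * exp (sqrt (real N)))) \<le> real N powr (- 4) / 4"
  defines "L \<equiv> (\<lambda>\<omega>. trunc_log (real N * exp (- 12)) (partition_Z U M N (curry \<omega>) / 2 ^ N))"
  shows "measure (gaussian_matrix M N) {\<omega> \<in> space (gaussian_matrix M N).
      sqrt (real N) * (ln (real N))\<^sup>2 \<le> \<bar>L \<omega> - (\<integral>\<omega>'. L \<omega>' \<partial>gaussian_matrix M N)\<bar>} \<le> 1 / (real N)\<^sup>2"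
proof -
  define l where "l = ln (real N)"
  define A where "A = real N * exp (- 12)"
  define n where "n = nat \<lfloor>sqrt (real N)\<rfloor>"
  define R where "R = sqrt (l / 8)"
  define T where "T = 9 * (exp (- (real n * (\<delta> / sqrt (2 * pi) * exp (- (K + R)\<^sup>2) * vol)))
       + real n * (2 * exp (- R\<^sup>2 / (2 * (1 / 128))) + exp A * exp (- (1 / 128) * real N / 4) * sqrt 2 ^ n))"
  have N: "N > 0" using sqN by (cases N) auto
  have l: "l \<ge> 2" using lnN by (simp add: l_def)
  have powr: "real N powr x = exp (x * l)" for x using N by (simp add: powr_def l_def)
  have n_le: "real n \<le> sqrt (real N)" and n_ge: "sqrt (real N) - 1 \<le> real n" using sqN unfolding n_def by linarith+
  have n2: "n \<ge> 2" using n_ge sqN by linarith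
  have R: "R \<ge> 0" "R\<^sup>2 = l / 8" using l by (auto simp: R_def)
  \<comment> \<open>The density bound \<open>exp A\<close> must stay well below \<open>exp (\<epsilon> N / 4) = exp (N / 512)\<close>.\<close>
  have e12: "exp (- 12 :: real) \<le> 1 / 4096"
  proof -
    have "(2 :: real) ^ 12 \<le> exp 1 ^ 12"
      using exp_ge_add_one_self[of "1 :: real"] by (intro power_mono) auto
    also have "\<dots> = exp (12 :: real)" by (simp flip: exp_of_nat_mult)
    finally show ?thesis by (simp add: exp_minus field_simps)
  qed
  have A: "A \<ge> 0" "A \<le> real N / 4096" "A \<le> real N"
    using e12 N mult_left_mono[OF e12, of "real N"] by (auto simp: A_def)
  have T0: "T \<ge> 0" unfolding T_def using \<delta> vol by (intro mult_nonneg_nonneg add_nonneg_nonneg) auto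
  have T: "T \<le> real N powr (- 4) / 4"
  proof -
    have "(K + R)\<^sup>2 \<le> 2 * K\<^sup>2 + l / 4"
    proof -
      have "(K + R)\<^sup>2 + (K - R)\<^sup>2 = 2 * K\<^sup>2 + 2 * R\<^sup>2" by (simp add: power2_eq_square algebra_simps)
      thus ?thesis using R(2) zero_le_power2[of "K - R"] by linarith
    qed
    hence "exp (- 2 * K\<^sup>2) * real N powr (- 1 / 4) \<le> exp (- (K + R)\<^sup>2)"
      by (simp add: powr flip: exp_add)
    hence "\<delta> / sqrt (2 * pi) * vol * (exp (- 2 * K\<^sup>2) * real N powr (- 1 / 4)) \<le> \<delta> / sqrt (2 * pi) * vol * exp (- (K + R)\<^sup>2)"
      using \<delta> vol by (intro mult_left_mono) auto
    hence "\<delta> / sqrt (2 * pi) * exp (- 2 * K\<^sup>2) * vol * real N powr (- 1 / 4) \<le> \<delta> / sqrt (2 * pi) * exp (- (K + R)\<^sup>2) * vol"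
      by (simp only: mult_ac)
    from mult_mono[OF n_ge this]
    have "(sqrt (real N) - 1) * (\<delta> / sqrt (2 * pi) * exp (- 2 * K\<^sup>2) * vol * real N powr (- 1 / 4))
        \<le> real n * (\<delta> / sqrt (2 * pi) * exp (- (K + R)\<^sup>2) * vol)"
      using \<delta> vol by simp
    hence e1: "exp (- (real n * (\<delta> / sqrt (2 * pi) * exp (- (K + R)\<^sup>2) * vol)))
        \<le> exp (- ((sqrt (real N) - 1) * (\<delta> / sqrt (2 * pi) * exp (- 2 * K\<^sup>2) * vol * real N powr (- 1 / 4))))"
      by simp
    have e2: "2 * exp (- R\<^sup>2 / (2 * (1 / 128))) = 2 * real N powr (- 8)"
      by (simp add: powr R)
    have "sqrt 2 ^ n \<le> exp 1 ^ n"
      using exp_ge_add_one_self[of "1 :: real"] sqrt2_less_2 by (intro power_mono) auto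
    also have "\<dots> = exp (real n)" by (simp flip: exp_of_nat_mult)
    also have "\<dots> \<le> exp (sqrt (real N))" using n_le by simp
    finally have h1: "sqrt 2 ^ n \<le> exp (sqrt (real N))" .
    have h2: "exp A * exp (- (1 / 128) * real N / 4) \<le> exp (- (7 / 4096) * real N)"
      using A by (simp flip: exp_add)
    have e3: "exp A * exp (- (1 / 128) * real N / 4) * sqrt 2 ^ n \<le> exp (- (7 / 4096) * real N) * exp (sqrt (real N))"
      by (rule mult_mono[OF h2 h1]) auto
    have h3: "real n * (2 * real N powr (- 8) + exp A * exp (- (1 / 128) * real N / 4) * sqrt 2 ^ n)
        \<le> sqrt (real N) * (2 * real N powr (- 8) + exp (- (7 / 4096) * real N) * exp (sqrt (real N)))"
      by (rule mult_mono[OF n_le]) (use e3 in auto)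
    have "T \<le> 9 * (exp (- ((sqrt (real N) - 1) * (\<delta> / sqrt (2 * pi) * exp (- 2 * K\<^sup>2) * vol * real N powr (- 1 / 4))))
     + sqrt (real N) * (2 * real N powr (- 8) + exp (- (7 / 4096) * real N) * exp (sqrt (real N))))"
      unfolding T_def e2 by (rule mult_left_mono[OF add_mono[OF e1 h3]]) simp
    thus ?thesis using small by linarith
  qed
  define t where "t = sqrt (real N) * l\<^sup>2 / 2"
  have t1: "t \<ge> 1" using large by (simp add: t_def l_def)
  define \<Omega> where "\<Omega> = gauss ({..<M} \<times> {..<N})"
  define H where "H a \<omega> = trunc_log A (cavity_Z U M N a (curry \<omega>) / 2 ^ N)" for a and \<omega> :: "nat \<times> nat \<Rightarrow> real"
  note [measurable] = measurable_partition_Z[OF U]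
  have L: "L = (\<lambda>\<omega>. trunc_log A (partition_Z U M N (curry \<omega>) / 2 ^ N))"
    by (simp add: L_def A_def)
  have un: "(\<Union>a<M. {a} \<times> {..<N}) = {..<M} \<times> {..<N}" by auto
  have pb: "0 \<le> partition_Z U M N G" "partition_Z U M N G \<le> 2 ^ N" for G
  proof -
    show "0 \<le> partition_Z U M N G"
      unfolding partition_Z_def using U01 by (intro sum_nonneg prod_nonneg) auto
    have "partition_Z U M N G \<le> (\<Sum>J\<in>cube {..<N}. 1)"
      unfolding partition_Z_def using U01 by (intro sum_mono prod_le_1) auto
    thus "partition_Z U M N G \<le> 2 ^ N"
      by (simp add: card_PiE numeral_2_eq_2)
  qed
  have "measure \<Omega> {\<omega> \<in> space \<Omega>. t + t \<le> \<bar>L \<omega> - (\<integral>\<omega>'. L \<omega>' \<partial>\<Omega>)\<bar>}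
      \<le> 2 * exp (- 2 * t\<^sup>2 / (real N * (ln (real n))\<^sup>2)) + 2 * real M * (A * T) / t"
  proof (rule block_concentration[where Mi = "\<lambda>_. std_gaussian" and B = "\<lambda>a. {a} \<times> {..<N}" and H = H and K = A])
    show "prob_space std_gaussian" by (rule prob_space_std_gaussian)
    show "\<Omega> = (\<Pi>\<^sub>M i\<in>(\<Union>a<M. {a} \<times> {..<N}). std_gaussian)" unfolding un \<Omega>_def gauss_def ..
    show "L \<in> borel_measurable \<Omega>" unfolding L \<Omega>_def by measurable
    show "\<bar>L x\<bar> \<le> A" for x
      using trunc_log_bounds[OF A(1), of "partition_Z U M N (curry x) / 2 ^ N"] pb[of "curry x"] by (simp add: L)
    show "H a \<in> borel_measurable \<Omega>" for a unfolding H_def \<Omega>_def by measurable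
    show "\<bar>H a x\<bar> \<le> A" if "a < M" for a x
      using trunc_log_bounds[OF A(1), of "cavity_Z U M N a (curry x) / 2 ^ N"] cavity_Z_bounds(3)[OF U01 that, where N = N and G = "curry x"]
      by (simp add: H_def)
    show "L x \<le> H a x" if "a < M" for a x
      unfolding L H_def using cavity_Z_bounds(2)[OF U01 that] by (intro trunc_log_mono divide_right_mono) auto
    show "H a x = H a y" if "\<forall>i\<in>(\<Union>a<M. {a} \<times> {..<N}) - {a} \<times> {..<N}. x i = y i" for a x y
      unfolding H_def cavity_Z_def
      by (intro arg_cong[of _ _ "trunc_log A"] arg_cong2[of _ _ _ _ "(/)"] sum.cong prod.cong arg_cong[of _ _ U] refl)
         (use that in \<open>auto intro!: sum.cong\<close>)
    show "(\<integral>x. max 0 (H a x - L x - ln (real n)) \<partial>\<Omega>) \<le> A * T" if "a < M" for a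
      unfolding H_def L \<Omega>_def T_def
      by (rule row_excess_le[OF N that A(1) _ _ R(1) U U01 E hit \<delta> vol n2]) auto
  qed (use MN N n2 t1 in auto)
  also have "2 * exp (- 2 * t\<^sup>2 / (real N * (ln (real n))\<^sup>2)) \<le> 1 / (2 * (real N)\<^sup>2)"
  proof -
    have n0: "ln (real n) > 0" using n2 by simp
    have "ln (real n) \<le> ln (sqrt (real N))" using n2 n_le by (intro ln_mono) auto
    hence ln: "ln (real n) \<le> l / 2" using N by (simp add: ln_sqrt l_def)
    have "4 * l * (ln (real n))\<^sup>2 \<le> 4 * l * (l / 2)\<^sup>2"
      using ln n0 l by (intro mult_left_mono power_mono) auto
    also have "\<dots> = l * l\<^sup>2" by (simp add: power2_eq_square)
    also have "\<dots> \<le> (l\<^sup>2 / 2) * l\<^sup>2"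
      using l by (intro mult_right_mono) (auto simp: power2_eq_square)
    finally have "4 * l * (real N * (ln (real n))\<^sup>2) \<le> real N * ((l\<^sup>2 / 2) * l\<^sup>2)"
      using N by (simp add: mult.left_commute mult_left_mono)
    also have "\<dots> = 2 * t\<^sup>2" by (simp add: t_def power_mult_distrib power_divide power2_eq_square)
    finally have "4 * l \<le> 2 * t\<^sup>2 / (real N * (ln (real n))\<^sup>2)"
      using N n0 by (simp add: field_simps)
    hence "2 * exp (- 2 * t\<^sup>2 / (real N * (ln (real n))\<^sup>2)) \<le> 2 * exp (- (4 * l))" by simp
    also have "\<dots> = 2 / real N ^ 4"
    proof -
      have "exp (4 * l) = real N ^ 4" using exp_of_nat_mult[of 4 l] N by (simp add: l_def)
      thus ?thesis by (simp add: exp_minus divide_inverse)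
    qed
    also have "\<dots> \<le> 1 / (2 * (real N)\<^sup>2)"
    proof -
      have "N \<ge> 2" using sqN by (cases "N \<ge> 2") (auto simp: not_le less_2_cases_iff)
      hence "2 ^ 2 \<le> (real N)\<^sup>2" by (intro power_mono) auto
      thus ?thesis using N by (simp add: field_simps power_numeral_reduce)
    qed
    finally show ?thesis .
  qed
  also have "2 * real M * (A * T) / t \<le> 1 / (2 * (real N)\<^sup>2)"
  proof -
    have "2 * real M * (A * T) / t \<le> 2 * real M * (A * T) / 1"
      using t1 A T0 by (intro divide_left_mono) auto
    also have "\<dots> \<le> 2 * real N * (real N * (real N powr (- 4) / 4))"
    proof -
      have AT: "A * T \<le> real N * (real N powr (- 4) / 4)"
        by (rule mult_mono[OF A(3) T]) (use T0 in auto)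
      have "2 * real M \<le> 2 * real N" using MN by simp
      from mult_mono[OF this AT] show ?thesis using A(1) T0 by simp
    qed
    also have "real N powr (- 4) = 1 / real N ^ 4"
      using N by (simp add: powr_minus powr_realpow[of _ 4, simplified] divide_inverse)
    also have "2 * real N * (real N * (1 / real N ^ 4 / 4)) = 1 / (2 * (real N)\<^sup>2)"
      using N by (simp add: field_simps power2_eq_square power4_eq_xxxx)
    finally show ?thesis .
  qed
  finally show ?thesis
    unfolding \<Omega>_def by (simp add: gaussian_matrix_eq t_def l_def)
qed

theorem proposition1p7:
  fixes vol Emax \<delta>' :: real
  assumes "vol > 0" and "\<delta>' > 0"
  shows "\<exists>N0. \<forall>U :: real \<Rightarrow> real. \<forall>E :: real set.
    U \<in> borel_measurable borel \<longrightarrow> range U \<subseteq> {0..1} \<longrightarrow>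
    (\<integral>\<xi>. \<xi> * U \<xi> \<partial>std_gaussian) \<noteq> 0 \<longrightarrow>
    E \<in> sets lebesgue \<longrightarrow> E \<subseteq> {- Emax..Emax} \<longrightarrow> measure lebesgue E = vol \<longrightarrow>
    (\<forall>x\<in>E. U x > \<delta>') \<longrightarrow>
    (\<forall>N\<ge>N0. \<forall>M\<le>N.
      let P = gaussian_matrix M N;
          L = (\<lambda>\<omega>. trunc_log (real N * exp (- 12)) (partition_Z U M N (curry \<omega>) / 2 ^ N))
      in measure P {\<omega> \<in> space P.
           1 / real N * \<bar>L \<omega> - (\<integral>\<omega>'. L \<omega>' \<partial>P)\<bar> \<ge> (ln (real N))\<^sup>2 / sqrt (real N)}
         \<le> 1 / (real N)\<^sup>2)"
proof -
  define \<kappa> where "\<kappa> = \<delta>' / sqrt (2 * pi) * exp (- 2 * Emax\<^sup>2) * vol"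
  have \<kappa>: "\<kappa> > 0" using assms by (simp add: \<kappa>_def)
  have "eventually (\<lambda>x::real. (ln x \<ge> 2 \<and> sqrt x \<ge> 3 \<and> sqrt x * (ln x)\<^sup>2 / 2 \<ge> 1) \<and>
     9 * (exp (- ((sqrt x - 1) * (\<kappa> * x powr (- 1 / 4))))
     + sqrt x * (2 * x powr (- 8) + exp (- (7 / 4096) * x) * exp (sqrt x))) \<le> x powr (- 4) / 4) at_top"
    by (rule eventually_conj[OF _ eventually_excess_negligible[OF \<kappa>]]) (intro eventually_conj; real_asymp)
  hence "eventually (\<lambda>N. (ln (real N) \<ge> 2 \<and> sqrt (real N) \<ge> 3 \<and> sqrt (real N) * (ln (real N))\<^sup>2 / 2 \<ge> 1) \<and>
     9 * (exp (- ((sqrt (real N) - 1) * (\<kappa> * real N powr (- 1 / 4))))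
     + sqrt (real N) * (2 * real N powr (- 8) + exp (- (7 / 4096) * real N) * exp (sqrt (real N)))) \<le> real N powr (- 4) / 4) sequentially"
    by (rule eventually_compose_filterlim[OF _ filterlim_real_sequentially])
  then obtain N0 where N0: "\<And>N. N \<ge> N0 \<Longrightarrow> (ln (real N) \<ge> 2 \<and> sqrt (real N) \<ge> 3 \<and> sqrt (real N) * (ln (real N))\<^sup>2 / 2 \<ge> 1) \<and>
     9 * (exp (- ((sqrt (real N) - 1) * (\<kappa> * real N powr (- 1 / 4))))
     + sqrt (real N) * (2 * real N powr (- 8) + exp (- (7 / 4096) * real N) * exp (sqrt (real N)))) \<le> real N powr (- 4) / 4"
    unfolding eventually_sequentially by blast
  show ?thesis
  proof (intro exI[of _ N0] allI impI)
    fix U :: "real \<Rightarrow> real" and E :: "real set" and N M :: nat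
    assume U [measurable]: "U \<in> borel_measurable borel" and U01: "range U \<subseteq> {0..1}"
      and E: "E \<in> sets lebesgue" "E \<subseteq> {- Emax..Emax}" "measure lebesgue E = vol" and hit: "\<forall>x\<in>E. U x > \<delta>'"
      and N: "N0 \<le> N" and MN: "M \<le> N"
    \<comment> \<open>\<open>E\<close> is only Lebesgue measurable; the Borel set \<open>E'\<close> contains it and serves as well.\<close>
    define E' where "E' = {x \<in> {- Emax..Emax}. \<delta>' < U x}"
    have E' [measurable]: "E' \<in> sets borel" unfolding E'_def by measurable
    have "vol \<le> measure lebesgue E'"
    proof -
      have "emeasure lebesgue E' \<le> emeasure lebesgue {- Emax..Emax}"
        by (rule emeasure_mono) (auto simp: E'_def)
      also have "\<dots> < \<infinity>" by (simp add: emeasure_lborel_Icc_eq)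
      finally have "E' \<in> fmeasurable lebesgue" using E' by (auto simp: fmeasurable_def)
      thus ?thesis unfolding E(3)[symmetric]
        using E hit by (intro measure_mono_fmeasurable) (auto simp: E'_def)
    qed
    hence vol: "vol \<le> measure lborel E'" using E' by (simp add: measure_completion)
    have N1: "N > 0" using N0[OF N] by (cases N) auto
    have sets_eq: "{\<omega> \<in> space P. 1 / real N * \<bar>L \<omega> - c\<bar> \<ge> (ln (real N))\<^sup>2 / sqrt (real N)}
        = {\<omega> \<in> space P. sqrt (real N) * (ln (real N))\<^sup>2 \<le> \<bar>L \<omega> - c\<bar>}"
      for P :: "(nat \<times> nat \<Rightarrow> real) measure" and L c
    proof -
      have "(1 / real N * y \<ge> (ln (real N))\<^sup>2 / sqrt (real N)) = (sqrt (real N) * (ln (real N))\<^sup>2 \<le> y)" for y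
      proof -
        have "(ln (real N))\<^sup>2 / sqrt (real N) = sqrt (real N) * (ln (real N))\<^sup>2 / real N"
          using N1 by (simp add: field_simps flip: power2_eq_square)
        thus ?thesis using N1 by (simp add: divide_le_cancel)
      qed
      thus ?thesis by simp
    qed
    show "let P = gaussian_matrix M N;
          L = (\<lambda>\<omega>. trunc_log (real N * exp (- 12)) (partition_Z U M N (curry \<omega>) / 2 ^ N))
      in measure P {\<omega> \<in> space P.
           1 / real N * \<bar>L \<omega> - (\<integral>\<omega>'. L \<omega>' \<partial>P)\<bar> \<ge> (ln (real N))\<^sup>2 / sqrt (real N)}
         \<le> 1 / (real N)\<^sup>2"
      unfolding Let_def sets_eq
    proof (rule gaussian_partition_concentration[OF U _ _ E' _ _ assms(2) vol _ MN])
      have "U x \<in> {0..1}" for x using U01 by blast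
      thus "0 \<le> U x" "U x \<le> 1" for x by auto
    qed (use assms N0[OF N] in \<open>auto simp: E'_def \<kappa>_def\<close>)
  qed
qed

end
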